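(* Assume in addition that $\Phi\in C^1([0,\infty))$. Let $\alpha>0$, $y_0\in BV(\mathbb R)$ with $y_0\ge1$, and let $w_\alpha$ be a bounded, Lipschitz continuous weak solution with values in $[1,\infty)$ of $\partial_t w_\alpha=\partial_z\overline{W(w_\alpha)}$, $w_\alpha(\cdot,0)=\overline{y_0}$. Let $\eta\in C^2$ be convex and $Q$ satisfy $Q'(w)=\eta'(w)W'(w)$. Then, in the sense of distributions (and a.e.), $$\partial_t\eta(w_\alpha(z,t))+D(z,t)=\partial_z\overline{Q(w_\alpha)}(z,t),$$ where $$D(z,t)=\int_0^\infty(-\Phi_\alpha')(\zeta)\int_{w_\alpha(z,t)}^{w_\alpha(z+\zeta,t)}\int_{w_\alpha(z,t)}^{\sigma}\eta''(\mu)\,W'(\sigma)\,d\mu\,d\sigma\,d\zeta\ \ge 0.$$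
   Context: Kernel: $\Phi:[0,\infty)\to[0,\infty)$ is non-increasing with $\int_0^\infty\Phi(z)\,dz=1$ and $\int_0^\infty z\Phi(z)\,dz<\infty$; for $\alpha>0$, $\Phi_\alpha(z)=\alpha^{-1}\Phi(z/\alpha)$, and for bounded measurable $h:\mathbb R\to\mathbb R$, $\overline h(z)=\int_0^\infty\Phi_\alpha(\zeta)h(z+\zeta)\,d\zeta$. Flux: $V\in C^1([0,\infty))$ is non-increasing and $W:[1,\infty)\to\mathbb R$, $W(w)=V(1/w)$ (non-decreasing). A weak solution of $\partial_t w=\partial_z\overline{W(w)}$ on $[0,T]$ with initial datum $w_0$ means $\int_0^T\!\int_{\mathbb R}w\partial_t\varphi-\overline{W(w)}\partial_z\varphi\,dz\,dt=\int_{\mathbb R}w(z,T)\varphi(z,T)-w_0(z)\varphi(z,0)\,dz$ for all $\varphi\in C_0^\infty(\mathbb R\times[0,T])$, for every $T>0$. *)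

theory Defs
  imports "HOL-Analysis.Analysis"
begin

definition Phi_alpha :: "(real \<Rightarrow> real) \<Rightarrow> real \<Rightarrow> real \<Rightarrow> real" where
  "Phi_alpha \<Phi> \<alpha> z = \<Phi> (z / \<alpha>) / \<alpha>"

definition mollify :: "(real \<Rightarrow> real) \<Rightarrow> real \<Rightarrow> (real \<Rightarrow> real) \<Rightarrow> real \<Rightarrow> real" where
  "mollify \<Phi> \<alpha> h z = (LINT \<zeta>:{0..}|lborel. Phi_alpha \<Phi> \<alpha> \<zeta> * h (z + \<zeta>))"

definition Wflux :: "(real \<Rightarrow> real) \<Rightarrow> real \<Rightarrow> real" where
  "Wflux V w = V (1 / w)"

definition kernel :: "(real \<Rightarrow> real) \<Rightarrow> bool" where
  "kernel \<Phi> \<longleftrightarrow> (\<forall>z\<ge>0. \<Phi> z \<ge> 0)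
     \<and> (\<forall>x y. 0 \<le> x \<longrightarrow> x \<le> y \<longrightarrow> \<Phi> y \<le> \<Phi> x)
     \<and> set_integrable lborel {0..} \<Phi>
     \<and> (LINT z:{0..}|lborel. \<Phi> z) = 1
     \<and> set_integrable lborel {0..} (\<lambda>z. z * \<Phi> z)"

definition BV :: "(real \<Rightarrow> real) \<Rightarrow> bool" where
  "BV f \<longleftrightarrow> (\<exists>M. \<forall>xs. sorted xs \<longrightarrow>
      (\<Sum>i<length xs - 1. \<bar>f (xs ! Suc i) - f (xs ! i)\<bar>) \<le> M)"

text \<open>C^infinity functions on R^2 (coordinates (z,t)): there is a family of functions
  containing phi, closed under taking the two partial derivatives, all of which are
  (Frechet) differentiable everywhere.\<close>
definition smooth2 :: "(real \<times> real \<Rightarrow> real) \<Rightarrow> bool" where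
  "smooth2 \<phi> \<longleftrightarrow> (\<exists>S. \<phi> \<in> S \<and> (\<forall>g\<in>S. \<exists>gz\<in>S. \<exists>gt\<in>S. \<forall>p.
      (g has_derivative (\<lambda>(dz, dt). gz p * dz + gt p * dt)) (at p)))"

definition tsupport :: "(real \<times> real \<Rightarrow> real) \<Rightarrow> (real \<times> real) set" where
  "tsupport \<phi> = closure {p. \<phi> p \<noteq> 0}"

text \<open>Test functions in C_0^infty(R x [0,T]) (restrictions of compactly supported smooth
  functions on R^2), together with their partial derivatives phi_z, phi_t.\<close>
definition test_fun :: "(real \<times> real \<Rightarrow> real) \<Rightarrow> (real \<times> real \<Rightarrow> real) \<Rightarrow> (real \<times> real \<Rightarrow> real) \<Rightarrow> bool" where
  "test_fun \<phi> \<phi>z \<phi>t \<longleftrightarrow> smooth2 \<phi> \<and> compact (tsupport \<phi>)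
     \<and> (\<forall>p. (\<phi> has_derivative (\<lambda>(dz, dt). \<phi>z p * dz + \<phi>t p * dt)) (at p))"

definition weak_solution ::
  "(real \<Rightarrow> real) \<Rightarrow> real \<Rightarrow> (real \<Rightarrow> real) \<Rightarrow> (real \<Rightarrow> real \<Rightarrow> real) \<Rightarrow> (real \<Rightarrow> real) \<Rightarrow> bool" where
  "weak_solution \<Phi> \<alpha> V w w0 \<longleftrightarrow> (\<forall>T>0. \<forall>\<phi> \<phi>z \<phi>t. test_fun \<phi> \<phi>z \<phi>t \<longrightarrow>
     (LINT t:{0..T}|lborel. LINT z|lborel.
        w z t * \<phi>t (z, t) - mollify \<Phi> \<alpha> (\<lambda>s. Wflux V (w s t)) z * \<phi>z (z, t))
     = (LINT z|lborel. w z T * \<phi> (z, T) - w0 z * \<phi> (z, 0)))"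

text \<open>The dissipation term D(z,t), with Phi_alpha' = dPa and W' = dW, eta'' = d2eta.\<close>
definition dissipation ::
  "(real \<Rightarrow> real) \<Rightarrow> (real \<Rightarrow> real) \<Rightarrow> (real \<Rightarrow> real) \<Rightarrow> (real \<Rightarrow> real \<Rightarrow> real) \<Rightarrow> real \<Rightarrow> real \<Rightarrow> real" where
  "dissipation dPa d2eta dW w z t =
     (LINT \<zeta>:{0..}|lborel. (- dPa \<zeta>) *
        (LBINT \<sigma>=ereal (w z t)..ereal (w (z + \<zeta>) t).
           (LBINT \<mu>=ereal (w z t)..ereal \<sigma>. d2eta \<mu> * dW \<sigma>)))"

end

theory Submission
  imports Defs
begin

text \<open>
  For a bounded Lipschitz function \<open>h\<close>, integration by parts against the kernel shows that
  \<open>\<partial>\<^sub>z\<close> of its average is \<open>\<integral>\<^sub>0\<^sup>\<infinity> (-\<Phi>\<^sub>\<alpha>')(\<zeta>) (h(z + \<zeta>) - h(z)) d\<zeta>\<close>, which is again Lipschitz.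
  Applied to \<open>h = W(w)\<close>, the right-hand side of the equation is continuous in \<open>(z, t)\<close>, so testing
  the weak formulation with concentrating bumps shows that \<open>w\<close> is differentiable in \<open>t\<close> at every point
  of the open half plane and solves the equation there. Multiplying by \<open>\<eta>'(w)\<close> and subtracting the
  same formula for \<open>h = Q(w)\<close> leaves
  \<open>\<integral>\<^sub>0\<^sup>\<infinity> (-\<Phi>\<^sub>\<alpha>')(\<zeta>) [Q(b) - Q(a) - \<eta>'(a)(W(b) - W(a))] d\<zeta>\<close> with \<open>a = w(z, t)\<close>, \<open>b = w(z + \<zeta>, t)\<close>;
  the bracket is the double integral in \<open>D\<close>, which is nonnegative because \<open>\<eta>'\<close> and \<open>W\<close> are monotone.
\<close>

subsection \<open>Calculus on the half line\<close>

text \<open>\<open>W(w)\<close> is no smoother than \<open>w\<close>, so the equation cannot be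
  expanded by a chain rule at the outset. The averaging repairs this: after integration by parts
  only undifferentiated increments remain, weighted by \<open>-\<Phi>\<^sub>\<alpha>'\<close>, a
  nonnegative weight of total mass \<open>\<Phi>\<^sub>\<alpha>(0)\<close>. This mass is the origin
  of the constants \<open>2 * C * k 0\<close>; the factor 2 appears because an increment consists of
  two values. Boundary terms at infinity vanish because a decreasing integrable kernel satisfies
  \<open>x * k x \<longrightarrow> 0\<close>, which beats the at most linear growth of an
  antiderivative of a bounded function. Since \<open>w\<close> may take the value 1, where
  \<open>W\<close> and \<open>Q\<close> are only assumed differentiable from the right, their
  derivatives are taken within \<open>{1..}\<close>.\<close>

lemma FTC_half_line_nonneg:
  fixes F f :: "real \<Rightarrow> real"
  assumes F: "\<And>x. 0 \<le> x \<Longrightarrow> (F has_real_derivative f x) (at x within {0..})"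
    and f: "continuous_on {0..} f"
    and f0: "\<And>x. 0 \<le> x \<Longrightarrow> 0 \<le> f x"
    and lim: "(F \<longlongrightarrow> B) at_top"
  shows "set_integrable lborel {0..} f" "(LINT x:{0..}|lborel. f x) = B - F 0"
proof -
  have F': "DERIV F x :> f x" if "0 < x" for x
    using F[of x] that at_within_interior[of x "{0..}"] by (simp add: interior_real_atLeast)
  have f': "isCont f x" if "0 < x" for x
    using f that by (simp add: continuous_on_interior interior_real_atLeast)
  have "continuous_on {0..} F"
    using F by (intro DERIV_continuous_on) auto
  then have "(F \<longlongrightarrow> F 0) (at 0 within {0..})"
    by (simp add: continuous_on)
  then have A: "(F \<longlongrightarrow> F 0) (at_right 0)"
    by (rule tendsto_within_subset) auto
  have 1: "set_integrable lborel (einterval (ereal 0) \<infinity>) f"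
    and 2: "(LBINT x=ereal 0..\<infinity>. f x) = B - F 0"
    by (rule interval_integral_FTC_nonneg[where F = F];
        use F' f' f0 A lim in \<open>auto simp: ereal_tendsto_simps\<close>)+
  have e: "einterval (ereal 0) \<infinity> = {0<..}"
    by (auto simp: einterval_iff)
  show "set_integrable lborel {0..} f"
    using 1 unfolding e
    by (subst set_integrable_discrete_difference[where X = "{0}" and B = "{0<..}"]) auto
  have "(LINT x:{0..}|lborel. f x) = (LINT x:{0<..}|lborel. f x)"
    by (rule set_integral_discrete_difference[where X = "{0}"]) auto
  also have "\<dots> = B - F 0"
    using 2 by (simp add: interval_lebesgue_integral_def e)
  finally show "(LINT x:{0..}|lborel. f x) = B - F 0" .
qed

text \<open>For a derivative of varying sign a limit of \<open>F\<close> gives only an improper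
  integral, so integrability is a hypothesis here; for a nonnegative derivative it follows from the
  limit.\<close>

lemma FTC_half_line:
  fixes F f :: "real \<Rightarrow> real"
  assumes F: "\<And>x. 0 \<le> x \<Longrightarrow> (F has_real_derivative f x) (at x within {0..})"
    and f: "continuous_on {0..} f"
    and int: "set_integrable lborel {0..} f"
    and lim: "(F \<longlongrightarrow> B) at_top"
  shows "(LINT x:{0..}|lborel. f x) = B - F 0"
proof -
  have "((\<lambda>b. LINT x:{0..b}|lborel. f x) \<longlongrightarrow> (LINT x:{0..}|lborel. f x)) at_top"
    by (rule tendsto_set_lebesgue_integral_at_top[OF _ int]) auto
  moreover have "(LINT x:{0..b}|lborel. f x) = F b - F 0" if "0 \<le> b" for b
    unfolding set_lebesgue_integral_def
    by (rule integral_FTC_atLeastAtMost[OF that])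
       (use F f in \<open>auto simp: has_real_derivative_iff_has_vector_derivative[symmetric]
          intro: has_field_derivative_subset[where s = "{0..}"] continuous_on_subset\<close>)
  then have "\<forall>\<^sub>F b in at_top. (LINT x:{0..b}|lborel. f x) = F b - F 0"
    by (intro eventually_mono[OF eventually_ge_at_top[of 0]])
  ultimately have "((\<lambda>b. F b - F 0) \<longlongrightarrow> (LINT x:{0..}|lborel. f x)) at_top"
    by (blast intro: Lim_transform_eventually)
  moreover have "((\<lambda>b. F b - F 0) \<longlongrightarrow> B - F 0) at_top"
    using lim by (intro tendsto_intros)
  ultimately show ?thesis
    using tendsto_unique trivial_limit_at_top_linorder by blast
qed

text \<open>The difference quotient is off by at most \<open>C * \<bar>y - x\<bar>\<close>.
  Differentiability of kernel averages in \<open>z\<close> and of \<open>w\<close> in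
  \<open>t\<close> is proved through such explicit quadratic errors.\<close>

lemma has_real_derivative_quadratic_bound:
  fixes f :: "real \<Rightarrow> real"
  assumes "\<delta> > 0" and b: "\<And>y. \<bar>y - x\<bar> < \<delta> \<Longrightarrow> \<bar>f y - f x - (y - x) * D\<bar> \<le> C * (y - x)\<^sup>2"
  shows "(f has_real_derivative D) (at x)"
  unfolding has_field_derivative_iff
proof (rule LIM_zero_cancel, rule tendsto_rabs_zero_cancel)
  have "\<forall>\<^sub>F y in at x. \<bar>(f y - f x) / (y - x) - D\<bar> \<le> C * \<bar>y - x\<bar>"
  proof -
    have "\<forall>\<^sub>F y in at x. \<bar>y - x\<bar> < \<delta> \<and> y \<noteq> x"
      using \<open>\<delta> > 0\<close> by (auto simp: eventually_at dist_real_def)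
    then show ?thesis
    proof eventually_elim
      case (elim y)
      have "(f y - f x) / (y - x) - D = (f y - f x - (y - x) * D) / (y - x)"
        using elim by (simp add: field_simps)
      then have "\<bar>(f y - f x) / (y - x) - D\<bar> = \<bar>f y - f x - (y - x) * D\<bar> / \<bar>y - x\<bar>"
        by simp
      also have "\<dots> \<le> C * (y - x)\<^sup>2 / \<bar>y - x\<bar>"
        using b elim by (intro divide_right_mono) auto
      also have "\<dots> = C * \<bar>y - x\<bar>"
        using elim by (cases "x < y") (auto simp: power2_eq_square field_simps)
      finally show ?case .
    qed
  qed
  moreover have "((\<lambda>y. C * \<bar>y - x\<bar>) \<longlongrightarrow> 0) (at x)"
    by (auto intro!: tendsto_eq_intros)
  ultimately show "((\<lambda>y. \<bar>(f y - f x) / (y - x) - D\<bar>) \<longlongrightarrow> 0) (at x)"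
    by - (rule tendsto_sandwich[OF always_eventually _ tendsto_const], auto)
qed

text \<open>The filter is one-sided at \<open>x = a\<close> and two-sided beyond. Right-hand
  difference quotients treat both cases at once, and they suffice for uniqueness and for the sign of
  a derivative.\<close>

lemma deriv_atLeast_at_right:
  fixes f :: "real \<Rightarrow> real"
  assumes "(f has_real_derivative D) (at x within {a..})" "a \<le> x"
  shows "((\<lambda>y. (f y - f x) / (y - x)) \<longlongrightarrow> D) (at_right x)"
  using assms(1) unfolding has_field_derivative_iff
  by (rule tendsto_within_subset) (use assms(2) in auto)

lemma deriv_atLeast_unique:
  fixes f :: "real \<Rightarrow> real"
  assumes "(f has_real_derivative D) (at x within {a..})" "(f has_real_derivative E) (at x within {a..})" "a \<le> x"
  shows "D = E"
  by (rule tendsto_unique[OF trivial_limit_at_right_real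
        deriv_atLeast_at_right[OF assms(1,3)] deriv_atLeast_at_right[OF assms(2,3)]])

lemma deriv_atLeast_nonpos:
  fixes f :: "real \<Rightarrow> real"
  assumes "(f has_real_derivative D) (at x within {a..})" "a \<le> x" "\<And>y. x < y \<Longrightarrow> f y \<le> f x"
  shows "D \<le> 0"
proof (rule tendsto_upperbound[OF deriv_atLeast_at_right[OF assms(1,2)]])
  show "\<forall>\<^sub>F y in at_right x. (f y - f x) / (y - x) \<le> 0"
    using eventually_at_right_less[of x]
    by eventually_elim (use assms(3) in \<open>auto intro!: divide_nonpos_pos\<close>)
qed simp

section \<open>Decreasing kernels: decay at infinity and integrability of the derivative\<close>

locale decreasing_kernel =
  fixes k k' :: "real \<Rightarrow> real"
  assumes k_nonneg: "\<And>x. 0 \<le> x \<Longrightarrow> 0 \<le> k x"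
    and k_antimono: "\<And>x y. 0 \<le> x \<Longrightarrow> x \<le> y \<Longrightarrow> k y \<le> k x"
    and k_deriv: "\<And>x. 0 \<le> x \<Longrightarrow> (k has_real_derivative k' x) (at x within {0..})"
    and k'_cont: "continuous_on {0..} k'"
    and k_integrable: "set_integrable lborel {0..} k"
begin

lemma k_cont: "continuous_on {0..} k"
  using k_deriv by (intro DERIV_continuous_on) auto

lemma k'_nonpos: "0 \<le> x \<Longrightarrow> k' x \<le> 0"
  by (rule deriv_atLeast_nonpos[OF k_deriv]) (auto intro: k_antimono)

text \<open>By monotonicity \<open>k \<ge> k x\<close> on \<open>{x/2..x}\<close>, so
  \<open>x * k x\<close> is at most twice the integral of \<open>k\<close> over that interval, a
  difference of two partial integrals with the same limit.\<close>

lemma tendsto_mult_k: "((\<lambda>x. x * k x) \<longlongrightarrow> 0) at_top"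
proof -
  define K where "K = (\<lambda>x. LINT s:{0..x}|lborel. k s)"
  have K: "(K \<longlongrightarrow> (LINT s:{0..}|lborel. k s)) at_top"
    unfolding K_def by (rule tendsto_set_lebesgue_integral_at_top[OF _ k_integrable]) auto
  then have "((\<lambda>x. K (x * (1/2))) \<longlongrightarrow> (LINT s:{0..}|lborel. k s)) at_top"
    by (rule filterlim_compose)
       (rule filterlim_tendsto_pos_mult_at_top[where c = "1/2", THEN filterlim_cong[THEN iffD1, rotated -1]],
        auto intro!: filterlim_ident simp: mult.commute)
  with K have lim: "((\<lambda>x. 2 * (K x - K (x * (1/2)))) \<longlongrightarrow> 0) at_top"
    by (auto intro!: tendsto_eq_intros)
  have le: "x * k x \<le> 2 * (K x - K (x * (1/2)))" if "0 \<le> x" for x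
  proof -
    have int: "k integrable_on {a..b}" if "0 \<le> a" for a b
      using k_cont that by (intro integrable_continuous_real) (auto intro: continuous_on_subset)
    have KI: "K b = integral {0..b} k" for b
      unfolding K_def
      by (intro set_borel_integral_eq_integral set_integrable_subset[OF k_integrable]) auto
    have "K x - K (x * (1/2)) = integral {x * (1/2)..x} k"
      using Henstock_Kurzweil_Integration.integral_combine[where a = 0 and b = x and c = "x * (1/2)" and f = k] int[of 0 x] that
      by (simp add: KI)
    also have "\<dots> \<ge> integral {x * (1/2)..x} (\<lambda>_. k x)"
      using that by (intro integral_le int) (auto intro!: k_antimono)
    finally show ?thesis using that by simp
  qed
  show ?thesis
  proof (rule tendsto_sandwich[OF _ _ tendsto_const lim])
    show "\<forall>\<^sub>F x in at_top. 0 \<le> x * k x"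
      using eventually_ge_at_top[of 0] by eventually_elim (use k_nonneg in auto)
    show "\<forall>\<^sub>F x in at_top. x * k x \<le> 2 * (K x - K (x * (1/2)))"
      using eventually_ge_at_top[of 0] by eventually_elim (rule le)
  qed
qed

lemma tendsto_k: "(k \<longlongrightarrow> 0) at_top"
proof (rule tendsto_sandwich[OF _ _ tendsto_const tendsto_mult_k])
  show "\<forall>\<^sub>F x in at_top. 0 \<le> k x"
    using eventually_ge_at_top[of 0] by eventually_elim (rule k_nonneg)
  show "\<forall>\<^sub>F x in at_top. k x \<le> x * k x"
    using eventually_ge_at_top[of 1]
  proof eventually_elim
    case (elim x)
    then show ?case using k_nonneg[of x] by (simp add: mult_le_cancel_right1)
  qed
qed

text \<open>\<open>- k\<close> increases to 0, so its nonnegative derivative is integrable, with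
  total mass \<open>k 0\<close>.\<close>

lemma k'_integrable: "set_integrable lborel {0..} (\<lambda>x. - k' x)"
  and integral_k': "(LINT x:{0..}|lborel. - k' x) = k 0"
  using FTC_half_line_nonneg[where F = "\<lambda>x. - k x" and f = "\<lambda>x. - k' x" and B = 0] k_deriv k'_cont k'_nonpos
    tendsto_minus[OF tendsto_k]
  by (auto intro!: derivative_intros continuous_intros)

text \<open>\<open>K x - x * k x\<close> is a primitive of the nonnegative function
  \<open>- (x * k' x)\<close>, and it converges because \<open>k\<close> is integrable and
  \<open>x * k x\<close> tends to 0.\<close>

lemma mult_k'_integrable: "set_integrable lborel {0..} (\<lambda>x. x * k' x)"
proof -
  define K where "K = (\<lambda>x. integral {0..x} k)"
  have KL: "K b = (LINT s:{0..b}|lborel. k s)" for b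
    unfolding K_def
    by (intro set_borel_integral_eq_integral(2)[symmetric] set_integrable_subset[OF k_integrable]) auto
  have K: "(K \<longlongrightarrow> (LINT s:{0..}|lborel. k s)) at_top"
    unfolding KL by (rule tendsto_set_lebesgue_integral_at_top[OF _ k_integrable]) auto
  have DK: "(K has_real_derivative k x) (at x within {0..})" if "0 \<le> x" for x
  proof -
    have "(K has_real_derivative k x) (at x within {0..x+1})"
      unfolding K_def by (rule integral_has_real_derivative) (use k_cont that in \<open>auto intro: continuous_on_subset\<close>)
    moreover have "at x within {0..x+1} = at x within {0..}"
      by (rule at_within_nhd[of _ "{..<x+1}"]) auto
    ultimately show ?thesis by simp
  qed
  have "set_integrable lborel {0..} (\<lambda>x. - (x * k' x))"
  proof (rule FTC_half_line_nonneg[where F = "\<lambda>x. K x - x * k x"])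
    show "((\<lambda>x. K x - x * k x) has_real_derivative - (x * k' x)) (at x within {0..})" if "0 \<le> x" for x
      by (rule derivative_eq_intros DK k_deriv that refl | simp)+
    show "continuous_on {0..} (\<lambda>x. - (x * k' x))"
      by (intro continuous_intros k'_cont)
    show "0 \<le> - (x * k' x)" if "0 \<le> x" for x
      using k'_nonpos that by (simp add: mult_nonneg_nonpos)
    show "((\<lambda>x. K x - x * k x) \<longlongrightarrow> (LINT s:{0..}|lborel. k s) - 0) at_top"
      by (intro tendsto_diff K tendsto_mult_k)
  qed
  then show ?thesis
    by (simp add: set_integrable_def)
qed

end

subsection \<open>Averages against a decreasing kernel\<close>

lemma antiderivative_exists_real:
  fixes h :: "real \<Rightarrow> real"
  assumes "continuous_on UNIV h"
  obtains H where "\<And>x. (H has_real_derivative h x) (at x)"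
  using einterval_antiderivative[of "- \<infinity>" \<infinity> h] assms
  by (auto simp: continuous_on_eq_continuous_at has_real_derivative_iff_has_vector_derivative)

lemma increment_bound:
  fixes H :: "real \<Rightarrow> real"
  assumes H: "\<And>x. (H has_real_derivative h x) (at x)" and b: "\<And>x. \<bar>h x\<bar> \<le> M"
  shows "\<bar>H y - H x\<bar> \<le> M * \<bar>y - x\<bar>"
  using field_differentiable_bound[of UNIV H h M y x] H b by auto

text \<open>The mean value theorem yields \<open>h c\<close> with \<open>c\<close> between
  \<open>x\<close> and \<open>y\<close>, and the Lipschitz bound compares it with
  \<open>h x\<close>. The sharp constant would be \<open>C / 2\<close>; only the order
  matters.\<close>

lemma linearization_bound:
  fixes H :: "real \<Rightarrow> real"
  assumes H: "\<And>x. (H has_real_derivative h x) (at x)"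
    and lip: "\<And>x y. \<bar>h x - h y\<bar> \<le> C * \<bar>x - y\<bar>"
  shows "\<bar>H y - H x - (y - x) * h x\<bar> \<le> C * (y - x)\<^sup>2"
proof -
  have C: "0 \<le> C" using order_trans[OF abs_ge_zero lip[of 1 0]] by simp
  obtain c where c: "H y - H x = (y - x) * h c" "\<bar>c - x\<bar> \<le> \<bar>y - x\<bar>"
  proof (cases x y rule: linorder_cases)
    case less
    then show ?thesis using MVT2[of x y H h] H that by force
  next
    case greater
    then obtain c where "y < c" "c < x" "H x - H y = (x - y) * h c"
      using MVT2[of y x H h] H by blast
    then show ?thesis using that[of c] by (simp add: algebra_simps)
  qed (use that in auto)
  have "\<bar>H y - H x - (y - x) * h x\<bar> = \<bar>y - x\<bar> * \<bar>h c - h x\<bar>"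
    using c by (simp add: abs_mult[symmetric] algebra_simps)
  also have "\<dots> \<le> \<bar>y - x\<bar> * (C * \<bar>y - x\<bar>)"
    using c(2) C by (intro mult_left_mono order_trans[OF lip]) (auto intro: mult_left_mono)
  also have "\<dots> = C * \<bar>y - x\<bar>\<^sup>2"
    by (simp only: power2_eq_square mult_ac)
  finally show ?thesis by simp
qed

lemma set_integrable_continuous_bound:
  fixes f g :: "real \<Rightarrow> real"
  assumes "set_integrable lborel {0..} f" "continuous_on {0..} g"
    and "\<And>x. 0 \<le> x \<Longrightarrow> \<bar>g x\<bar> \<le> c * \<bar>f x\<bar>"
  shows "set_integrable lborel {0..} g"
proof (rule set_integrable_bound[where f = "\<lambda>x. c * f x"])
  show "set_integrable lborel {0..} (\<lambda>x. c * f x)"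
    using assms(1) by simp
  show "set_borel_measurable lborel {0..} g"
    using assms(2) borel_measurable_continuous_on_indicator[of "{0..}" g]
    by (simp add: set_borel_measurable_def)
  have "\<bar>g x\<bar> \<le> \<bar>c * f x\<bar>" if "0 \<le> x" for x
    using assms(3)[OF that] by (rule order_trans) (simp add: abs_mult mult_right_mono)
  then show "AE x in lborel. x \<in> {0..} \<longrightarrow> norm (g x) \<le> norm (c * f x)"
    by auto
qed

context decreasing_kernel
begin

lemma k'_mult_integrable:
  assumes "continuous_on {0..} g" "\<And>x. 0 \<le> x \<Longrightarrow> \<bar>g x\<bar> \<le> c"
  shows "set_integrable lborel {0..} (\<lambda>x. - k' x * g x)"
proof (rule set_integrable_continuous_bound[OF k'_integrable])
  show "continuous_on {0..} (\<lambda>x. - k' x * g x)"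
    by (intro continuous_intros assms k'_cont)
  show "\<bar>- k' x * g x\<bar> \<le> c * \<bar>- k' x\<bar>" if "0 \<le> x" for x
    using assms(2)[OF that] by (simp add: abs_mult mult.commute mult_right_mono)
qed

lemma k'_mult_integral_bound:
  assumes g: "continuous_on {0..} g" and c: "\<And>x. 0 \<le> x \<Longrightarrow> \<bar>g x\<bar> \<le> c"
  shows "\<bar>LINT x:{0..}|lborel. - k' x * g x\<bar> \<le> c * k 0"
proof -
  have i: "set_integrable lborel {0..} (\<lambda>x. - k' x * g x)"
    by (rule k'_mult_integrable[OF g c])
  have n: "- k' x \<ge> 0" if "0 \<le> x" for x
    using k'_nonpos[OF that] by simp
  have b: "\<bar>- k' x * g x\<bar> \<le> c * - k' x" if "0 \<le> x" for x
    using mult_right_mono[OF c[OF that] n[OF that]] n[OF that] by (simp add: abs_mult mult.commute)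
  have ci: "set_integrable lborel {0..} (\<lambda>x. c * - k' x)"
    using k'_integrable by (rule set_integrable_mult_right)
  have ce: "(LINT x:{0..}|lborel. c * - k' x) = c * k 0"
    by (simp only: set_integral_mult_right integral_k')
  have "(LINT x:{0..}|lborel. - k' x * g x) \<le> (LINT x:{0..}|lborel. c * - k' x)"
    using b by (intro set_integral_mono i ci) (force simp: abs_le_iff)
  moreover have "(LINT x:{0..}|lborel. - (- k' x * g x)) \<le> (LINT x:{0..}|lborel. c * - k' x)"
    using b i by (intro set_integral_mono ci) (force simp: abs_le_iff set_integrable_def)+
  ultimately show ?thesis
    unfolding ce by (simp add: set_lebesgue_integral_def)
qed

text \<open>The antiderivative is normalised to vanish at \<open>\<zeta> = 0\<close>, which removes
  the boundary term there. At infinity its increment is at most \<open>M * \<zeta>\<close>, so the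
  decay of \<open>\<zeta> * k \<zeta>\<close> removes the other one, and integrability of
  \<open>\<zeta> * k' \<zeta>\<close> makes the new integral converge.\<close>

lemma kernel_integral_by_parts:
  assumes H: "\<And>x. (H has_real_derivative h x) (at x)" and h: "continuous_on UNIV h"
    and M: "\<And>x. \<bar>h x\<bar> \<le> M"
  shows "set_integrable lborel {0..} (\<lambda>\<zeta>. - k' \<zeta> * (H (z + \<zeta>) - H z))"
    and "(LINT \<zeta>:{0..}|lborel. k \<zeta> * h (z + \<zeta>)) = (LINT \<zeta>:{0..}|lborel. - k' \<zeta> * (H (z + \<zeta>) - H z))"
proof -
  have Hc: "continuous_on UNIV H"
    using H by (intro DERIV_continuous_on) auto
  have inc: "\<bar>H (z + \<zeta>) - H z\<bar> \<le> M * \<zeta>" if "0 \<le> \<zeta>" for \<zeta>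
    using increment_bound[OF H M, of "z + \<zeta>" z] that by simp
  have c1: "continuous_on {0..} (\<lambda>\<zeta>. H (z + \<zeta>) - H z)" and c2: "continuous_on {0..} (\<lambda>\<zeta>. h (z + \<zeta>))"
    by (intro continuous_intros continuous_on_compose2[OF Hc] continuous_on_compose2[OF h]; simp)+
  show i1: "set_integrable lborel {0..} (\<lambda>\<zeta>. - k' \<zeta> * (H (z + \<zeta>) - H z))"
  proof (rule set_integrable_continuous_bound[OF mult_k'_integrable])
    show "continuous_on {0..} (\<lambda>\<zeta>. - k' \<zeta> * (H (z + \<zeta>) - H z))"
      by (intro continuous_intros k'_cont c1)
    show "\<bar>- k' \<zeta> * (H (z + \<zeta>) - H z)\<bar> \<le> M * \<bar>\<zeta> * k' \<zeta>\<bar>" if "0 \<le> \<zeta>" for \<zeta>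
      using mult_left_mono[OF inc[OF that], of "\<bar>k' \<zeta>\<bar>"] that by (simp add: abs_mult mult_ac)
  qed
  have i2: "set_integrable lborel {0..} (\<lambda>\<zeta>. k \<zeta> * h (z + \<zeta>))"
  proof (rule set_integrable_continuous_bound[OF k_integrable])
    show "continuous_on {0..} (\<lambda>\<zeta>. k \<zeta> * h (z + \<zeta>))"
      by (intro continuous_intros k_cont c2)
    show "\<bar>k \<zeta> * h (z + \<zeta>)\<bar> \<le> M * \<bar>k \<zeta>\<bar>" if "0 \<le> \<zeta>" for \<zeta>
      using mult_right_mono[OF M[of "z + \<zeta>"], of "\<bar>k \<zeta>\<bar>"] by (simp add: abs_mult mult.commute)
  qed
  have lim: "((\<lambda>\<zeta>. k \<zeta> * (H (z + \<zeta>) - H z)) \<longlongrightarrow> 0) at_top"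
  proof (rule Lim_null_comparison)
    show "\<forall>\<^sub>F \<zeta> in at_top. norm (k \<zeta> * (H (z + \<zeta>) - H z)) \<le> M * (\<zeta> * k \<zeta>)"
      using eventually_ge_at_top[of 0]
    proof eventually_elim
      case (elim \<zeta>)
      then show ?case
        using mult_left_mono[OF inc[OF elim], of "k \<zeta>"] k_nonneg[OF elim] by (simp add: abs_mult mult_ac)
    qed
    show "((\<lambda>\<zeta>. M * (\<zeta> * k \<zeta>)) \<longlongrightarrow> 0) at_top"
      using tendsto_mult_right_zero[OF tendsto_mult_k] .
  qed
  have "(LINT \<zeta>:{0..}|lborel. k \<zeta> * h (z + \<zeta>) - (- k' \<zeta> * (H (z + \<zeta>) - H z))) = 0 - k 0 * (H (z + 0) - H z)"
  proof (rule FTC_half_line[OF _ _ _ lim])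
    show "((\<lambda>\<zeta>. k \<zeta> * (H (z + \<zeta>) - H z)) has_real_derivative
        k \<zeta> * h (z + \<zeta>) - (- k' \<zeta> * (H (z + \<zeta>) - H z))) (at \<zeta> within {0..})" if "0 \<le> \<zeta>" for \<zeta>
    proof -
      have "((\<lambda>\<zeta>. H (z + \<zeta>)) has_real_derivative h (z + \<zeta>) * 1) (at \<zeta> within {0..})"
        by (rule DERIV_chain2[OF H]) (auto intro!: derivative_eq_intros)
      then show ?thesis
        using k_deriv[OF that] by (auto intro!: derivative_eq_intros)
    qed
    show "continuous_on {0..} (\<lambda>\<zeta>. k \<zeta> * h (z + \<zeta>) - (- k' \<zeta> * (H (z + \<zeta>) - H z)))"
      by (intro continuous_intros k_cont k'_cont c1 c2)
    show "set_integrable lborel {0..} (\<lambda>\<zeta>. k \<zeta> * h (z + \<zeta>) - (- k' \<zeta> * (H (z + \<zeta>) - H z)))"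
      by (rule set_integral_diff(1)[OF i2 i1])
  qed
  then show "(LINT \<zeta>:{0..}|lborel. k \<zeta> * h (z + \<zeta>)) = (LINT \<zeta>:{0..}|lborel. - k' \<zeta> * (H (z + \<zeta>) - H z))"
    unfolding set_integral_diff(2)[OF i2 i1] by simp
qed

text \<open>Formally the derivative of the average is the integral of
  \<open>k \<zeta> * h'(z + \<zeta>)\<close>; by parts it becomes \<open>- k 0 * h z\<close> plus
  the integral of \<open>- k' \<zeta> * h (z + \<zeta>)\<close>. Since \<open>- k'\<close> has
  integral \<open>k 0\<close>, both fit into one integral of increments.\<close>

definition jump :: "(real \<Rightarrow> real) \<Rightarrow> real \<Rightarrow> real" where
  "jump h z = (LINT \<zeta>:{0..}|lborel. - k' \<zeta> * (h (z + \<zeta>) - h z))"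

lemma jump_integrable:
  assumes f: "continuous_on UNIV f" and M: "\<And>x. \<bar>f x\<bar> \<le> M"
  shows "set_integrable lborel {0..} (\<lambda>\<zeta>. - k' \<zeta> * (f (z + \<zeta>) - f z))"
proof (rule k'_mult_integrable)
  show "continuous_on {0..} (\<lambda>\<zeta>. f (z + \<zeta>) - f z)"
    by (intro continuous_intros continuous_on_compose2[OF f]) auto
  show "\<bar>f (z + x) - f z\<bar> \<le> 2 * M" for x
    using M[of "z + x"] M[of z] by linarith
qed

text \<open>Moving the derivative onto the kernel: after integration by parts the average of \<open>h\<close>
  only involves increments of an antiderivative of \<open>h\<close>, which linearize with a quadratic error.\<close>

lemma has_derivative_kernel_integral:
  assumes lip: "\<And>x y. \<bar>h x - h y\<bar> \<le> C * \<bar>x - y\<bar>" and M: "\<And>x. \<bar>h x\<bar> \<le> M"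
  shows "((\<lambda>z. LINT \<zeta>:{0..}|lborel. k \<zeta> * h (z + \<zeta>)) has_real_derivative jump h z) (at z)"
proof -
  have C: "0 \<le> C" using order_trans[OF abs_ge_zero lip[of 1 0]] by simp
  have "C-lipschitz_on UNIV h"
    using lip C by (auto simp: lipschitz_on_def dist_real_def)
  then have h: "continuous_on UNIV h"
    by (rule lipschitz_on_continuous_on)
  obtain H where H: "\<And>x. (H has_real_derivative h x) (at x)"
    using antiderivative_exists_real[OF h] by blast
  have Hc: "continuous_on UNIV H"
    using H by (intro DERIV_continuous_on) auto
  note parts = kernel_integral_by_parts[OF H h M]
  note hi = jump_integrable[OF h M, of z]
  show ?thesis
    unfolding parts(2)
  proof (rule has_real_derivative_quadratic_bound[of 1 _ _ _ "2 * C * k 0"])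
    fix y
    \<comment> \<open>\<open>?E x\<close> is the error of linearising \<open>H\<close> at
      \<open>x\<close> with step \<open>y - z\<close>. The integrand collects one such error at
      \<open>z + \<zeta>\<close> and one at \<open>z\<close>, hence \<open>2 * C\<close>.\<close>
    let ?E = "\<lambda>x. H (y - z + x) - H x - (y - z) * h x"
    have E: "\<bar>?E x\<bar> \<le> C * (y - z)\<^sup>2" for x
      using linearization_bound[OF H lip, of "y - z + x" x] by simp
    have "(LINT \<zeta>:{0..}|lborel. - k' \<zeta> * (H (y + \<zeta>) - H y)) - (LINT \<zeta>:{0..}|lborel. - k' \<zeta> * (H (z + \<zeta>) - H z))
        - (y - z) * jump h z
      = (LINT \<zeta>:{0..}|lborel. - k' \<zeta> * (H (y + \<zeta>) - H y) - - k' \<zeta> * (H (z + \<zeta>) - H z)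
          - (y - z) * (- k' \<zeta> * (h (z + \<zeta>) - h z)))"
      unfolding jump_def
      using set_integral_diff(2)[OF set_integral_diff(1)[OF parts(1)[of y] parts(1)[of z]]
          set_integrable_mult_right[OF hi, of "y - z"]]
        set_integral_diff(2)[OF parts(1)[of y] parts(1)[of z]]
      by (simp only: set_integral_mult_right)
    also have "\<dots> = (LINT \<zeta>:{0..}|lborel. - k' \<zeta> * (?E (z + \<zeta>) - ?E z))"
      by (rule set_lebesgue_integral_cong) (auto simp: algebra_simps)
    also have "\<bar>\<dots>\<bar> \<le> (2 * C * (y - z)\<^sup>2) * k 0"
    proof (rule k'_mult_integral_bound)
      show "continuous_on {0..} (\<lambda>\<zeta>. ?E (z + \<zeta>) - ?E z)"
        by (intro continuous_intros continuous_on_compose2[OF h] continuous_on_compose2[OF Hc]) auto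
      show "\<bar>?E (z + \<zeta>) - ?E z\<bar> \<le> 2 * C * (y - z)\<^sup>2" for \<zeta>
        using E[of "z + \<zeta>"] E[of z] by linarith
    qed
    finally show "\<bar>(LINT \<zeta>:{0..}|lborel. - k' \<zeta> * (H (y + \<zeta>) - H y)) - (LINT \<zeta>:{0..}|lborel. - k' \<zeta> * (H (z + \<zeta>) - H z))
        - (y - z) * jump h z\<bar> \<le> 2 * C * k 0 * (y - z)\<^sup>2"
      by (simp add: mult_ac)
  qed simp
qed

end

subsection \<open>Smooth bump functions\<close>

text \<open>The classical \<open>exp (-1/x)\<close>, extended by zero, times powers of
  \<open>1/x\<close>. The powers are carried along because differentiation produces them; with them
  the family is closed under differentiation up to linear combinations.\<close>

definition flat_exp :: "nat \<Rightarrow> real \<Rightarrow> real" where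
  "flat_exp n x = (if 0 < x then exp (- inverse x) * inverse x ^ n else 0)"

lemma flat_exp_tendsto_0: "(flat_exp n \<longlongrightarrow> 0) (at 0)"
proof (rule filterlim_split_at)
  have "\<forall>\<^sub>F x in at_left (0::real). 0 = flat_exp n x"
    by (auto simp: eventually_at_filter flat_exp_def)
  then show "(flat_exp n \<longlongrightarrow> 0) (at_left 0)"
    by (rule Lim_transform_eventually[rotated]) simp
  have "((\<lambda>x::real. inverse x ^ n / exp (inverse x)) \<longlongrightarrow> 0) (at_right 0)"
    by (rule filterlim_compose[OF tendsto_power_div_exp_0 filterlim_inverse_at_top_right])
  moreover have "\<forall>\<^sub>F x in at_right (0::real). inverse x ^ n / exp (inverse x) = flat_exp n x"
    by (auto simp: eventually_at_filter flat_exp_def exp_minus field_simps)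
  ultimately show "(flat_exp n \<longlongrightarrow> 0) (at_right 0)"
    by (rule Lim_transform_eventually)
qed

text \<open>At 0 the difference quotient of \<open>flat_exp n\<close> is
  \<open>flat_exp (n + 1)\<close>, which tends to 0; on the positive side this is the product
  rule.\<close>

lemma flat_exp_deriv:
  "(flat_exp n has_real_derivative flat_exp (n + 2) x - real n * flat_exp (n + 1) x) (at x)"
proof (cases x "0::real" rule: linorder_cases)
  case less
  have "(flat_exp n has_real_derivative 0) (at x)"
  proof (rule DERIV_cong_ev[THEN iffD2, OF refl _ refl DERIV_const[of 0]])
    show "\<forall>\<^sub>F y in nhds x. flat_exp n y = 0"
      using eventually_nhds_in_open[of "{..<0}" x] less
      by (auto elim!: eventually_mono simp: flat_exp_def)
  qed
  then show ?thesis
    using less by (simp add: flat_exp_def)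
next
  case equal
  have "\<forall>\<^sub>F y in at 0. flat_exp (n + 1) y = (flat_exp n y - flat_exp n 0) / (y - 0)"
    by (auto simp: eventually_at_filter flat_exp_def field_simps)
  then have "((\<lambda>y. (flat_exp n y - flat_exp n 0) / (y - 0)) \<longlongrightarrow> 0) (at 0)"
    by (rule Lim_transform_eventually[OF flat_exp_tendsto_0])
  then show ?thesis
    using equal by (simp add: has_field_derivative_iff flat_exp_def)
next
  case greater
  have pos: "((\<lambda>x. exp (- inverse x) * inverse x ^ n) has_real_derivative
      flat_exp (n + 2) x - real n * flat_exp (n + 1) x) (at x)"
  proof (cases n)
    case (Suc m)
    have i: "(inverse has_real_derivative - (inverse x * inverse x)) (at x)"
      using DERIV_inverse'[OF DERIV_ident, of x] greater by (simp add: mult_ac)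
    have e: "((\<lambda>x. exp (- inverse x)) has_real_derivative exp (- inverse x) * - (- (inverse x * inverse x))) (at x)"
      using i by (intro DERIV_fun_exp DERIV_minus) auto
    show ?thesis
      unfolding Suc by (rule DERIV_cong[OF DERIV_mult[OF e DERIV_power_Suc[OF i, of m]]])
        (use greater in \<open>simp add: flat_exp_def algebra_simps\<close>)
  qed (use greater in \<open>auto intro!: derivative_eq_intros simp: flat_exp_def power2_eq_square\<close>)
  show ?thesis
  proof (rule DERIV_cong_ev[THEN iffD2, OF refl _ refl pos])
    show "\<forall>\<^sub>F y in nhds x. flat_exp n y = exp (- inverse y) * inverse y ^ n"
      using eventually_nhds_in_open[of "{0<..}" x] greater
      by (auto elim!: eventually_mono simp: flat_exp_def)
  qed
qed

lemma continuous_on_flat_exp: "continuous_on S (flat_exp n)"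
  by (rule DERIV_continuous_on[OF has_field_derivative_at_within[OF flat_exp_deriv]])

text \<open>\<open>smooth2\<close> asks for a set of functions closed under both partial
  derivatives, and this algebra serves as that set. Affine arguments provide the translations and
  reflections in either variable, and products provide the bumps.\<close>

inductive_set flat_exp_algebra :: "(real \<times> real \<Rightarrow> real) set" where
  gen: "(\<lambda>p. flat_exp n (a * fst p + b * snd p + c)) \<in> flat_exp_algebra"
| const: "(\<lambda>p. c) \<in> flat_exp_algebra"
| add: "f \<in> flat_exp_algebra \<Longrightarrow> g \<in> flat_exp_algebra \<Longrightarrow> (\<lambda>p. f p + g p) \<in> flat_exp_algebra"
| mult: "f \<in> flat_exp_algebra \<Longrightarrow> g \<in> flat_exp_algebra \<Longrightarrow> (\<lambda>p. f p * g p) \<in> flat_exp_algebra"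

lemma flat_exp_algebra_partials:
  assumes "g \<in> flat_exp_algebra"
  shows "\<exists>gz\<in>flat_exp_algebra. \<exists>gt\<in>flat_exp_algebra. \<forall>p.
    (g has_derivative (\<lambda>(dz, dt). gz p * dz + gt p * dt)) (at p)"
  using assms
proof induction
  case (gen n a b c)
  \<comment> \<open>\<open>D\<close> is the derivative of the profile at the affine argument; the
    partials are \<open>a * D\<close> and \<open>b * D\<close>. The difference is written as a sum
    with the factor \<open>- real n\<close> because the closure rules are those for sums and
    products.\<close>
  define D where "D = (\<lambda>p. flat_exp (n + 2) (a * fst p + b * snd p + c)
    + (- real n) * flat_exp (n + 1) (a * fst p + b * snd p + c))"
  have D: "D \<in> flat_exp_algebra"
    unfolding D_def by (intro flat_exp_algebra.intros)
  have "((\<lambda>p. flat_exp n (a * fst p + b * snd p + c)) has_derivative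
      (\<lambda>(dz, dt). (a * D p) * dz + (b * D p) * dt)) (at p)" for p
  proof -
    have 1: "(flat_exp n has_derivative (*) (D p)) (at (a * fst p + b * snd p + c))"
      using flat_exp_deriv[of n "a * fst p + b * snd p + c"]
      by (simp add: has_field_derivative_def D_def)
    have 2: "((\<lambda>p. a * fst p + b * snd p + c) has_derivative (\<lambda>h. a * fst h + b * snd h)) (at p)"
      by (auto intro!: derivative_eq_intros)
    show ?thesis
      using has_derivative_compose[OF 2 1]
      by (simp add: case_prod_unfold algebra_simps)
  qed
  moreover have "(\<lambda>p. a * D p) \<in> flat_exp_algebra" "(\<lambda>p. b * D p) \<in> flat_exp_algebra"
    using D by (auto intro: flat_exp_algebra.intros)
  ultimately show ?case
    by (intro bexI[of _ "\<lambda>p. a * D p"] bexI[of _ "\<lambda>p. b * D p"]) auto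
next
  case (const c)
  have "((\<lambda>p::real\<times>real. c) has_derivative (\<lambda>(dz, dt). 0 * dz + 0 * dt)) (at p)" for p
    by (auto simp: case_prod_unfold)
  then show ?case
    using flat_exp_algebra.const[of 0] by (intro bexI[of _ "\<lambda>p. 0"]) auto
next
  case (add f g)
  then obtain fz ft gz gt where in_alg: "fz \<in> flat_exp_algebra" "ft \<in> flat_exp_algebra"
      "gz \<in> flat_exp_algebra" "gt \<in> flat_exp_algebra"
    and d: "\<And>p. (f has_derivative (\<lambda>(dz, dt). fz p * dz + ft p * dt)) (at p)"
      "\<And>p. (g has_derivative (\<lambda>(dz, dt). gz p * dz + gt p * dt)) (at p)"
    by blast
  have "((\<lambda>p. f p + g p) has_derivative (\<lambda>(dz, dt). (fz p + gz p) * dz + (ft p + gt p) * dt)) (at p)" for p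
    by (rule has_derivative_eq_rhs[OF has_derivative_add[OF d]]) (auto simp: fun_eq_iff algebra_simps)
  then show ?case
    using in_alg by (intro bexI[of _ "\<lambda>p. fz p + gz p"] bexI[of _ "\<lambda>p. ft p + gt p"])
      (auto intro: flat_exp_algebra.add)
next
  case (mult f g)
  then obtain fz ft gz gt where in_alg: "fz \<in> flat_exp_algebra" "ft \<in> flat_exp_algebra"
      "gz \<in> flat_exp_algebra" "gt \<in> flat_exp_algebra"
    and d: "\<And>p. (f has_derivative (\<lambda>(dz, dt). fz p * dz + ft p * dt)) (at p)"
      "\<And>p. (g has_derivative (\<lambda>(dz, dt). gz p * dz + gt p * dt)) (at p)"
    by blast
  have "((\<lambda>p. f p * g p) has_derivative
      (\<lambda>(dz, dt). (f p * gz p + fz p * g p) * dz + (f p * gt p + ft p * g p) * dt)) (at p)" for p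
    by (rule has_derivative_eq_rhs[OF has_derivative_mult[OF d]]) (auto simp: fun_eq_iff algebra_simps)
  then show ?case
    using in_alg mult.hyps
    by (intro bexI[of _ "\<lambda>p. f p * gz p + fz p * g p"] bexI[of _ "\<lambda>p. f p * gt p + ft p * g p"])
      (auto intro: flat_exp_algebra.intros)
qed

definition bump :: "real \<Rightarrow> real \<Rightarrow> real \<Rightarrow> real" where
  "bump a b x = flat_exp 0 (x - a) * flat_exp 0 (b - x)"

definition bump' :: "real \<Rightarrow> real \<Rightarrow> real \<Rightarrow> real" where
  "bump' a b x = flat_exp 2 (x - a) * flat_exp 0 (b - x) - flat_exp 0 (x - a) * flat_exp 2 (b - x)"

lemma bump_nonneg: "0 \<le> bump a b x"
  by (simp add: bump_def flat_exp_def)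

lemma bump_pos: "a < x \<Longrightarrow> x < b \<Longrightarrow> 0 < bump a b x"
  by (simp add: bump_def flat_exp_def)

lemma bump_eq_0: "x \<le> a \<or> b \<le> x \<Longrightarrow> bump a b x = 0"
  and bump'_eq_0: "x \<le> a \<or> b \<le> x \<Longrightarrow> bump' a b x = 0"
  by (auto simp: bump_def bump'_def flat_exp_def)

lemma continuous_on_bump: "continuous_on S (bump a b)"
  and continuous_on_bump': "continuous_on S (bump' a b)"
  unfolding bump_def bump'_def atomize_conj
  by (intro conjI continuous_intros continuous_on_compose2[OF continuous_on_flat_exp[of UNIV]]) simp_all

lemma bump_deriv: "(bump a b has_real_derivative bump' a b x) (at x)"
proof -
  have d: "(flat_exp 0 has_real_derivative flat_exp 2 y) (at y)" for y
    using flat_exp_deriv[of 0 y] by (simp add: numeral_2_eq_2)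
  have "((\<lambda>x. flat_exp 0 (x - a)) has_real_derivative flat_exp 2 (x - a) * 1) (at x)"
    by (rule DERIV_chain2[OF d]) (auto intro!: derivative_eq_intros)
  moreover have "((\<lambda>x. flat_exp 0 (b - x)) has_real_derivative flat_exp 2 (b - x) * -1) (at x)"
    by (rule DERIV_chain2[OF d]) (auto intro!: derivative_eq_intros)
  ultimately show ?thesis
    unfolding bump_def[abs_def] bump'_def by (auto intro!: derivative_eq_intros)
qed

lemma test_fun_bump:
  "test_fun (\<lambda>(z, t). bump a b z * bump c d t)
     (\<lambda>(z, t). bump' a b z * bump c d t) (\<lambda>(z, t). bump a b z * bump' c d t)"
  unfolding test_fun_def
proof (intro conjI allI)
  \<comment> \<open>Each factor is spelled out as \<open>flat_exp\<close> of a full affine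
    expression, with explicit coefficients 0, 1 and -1, so that the generator rule matches.\<close>
  have "(\<lambda>(z, t). bump a b z * bump c d t) = (\<lambda>p.
      (flat_exp 0 (1 * fst p + 0 * snd p + (- a)) * flat_exp 0 ((- 1) * fst p + 0 * snd p + b)) *
      (flat_exp 0 (0 * fst p + 1 * snd p + (- c)) * flat_exp 0 (0 * fst p + (- 1) * snd p + d)))"
    by (auto simp: bump_def fun_eq_iff)
  also have "\<dots> \<in> flat_exp_algebra"
    by (intro flat_exp_algebra.intros)
  finally show "smooth2 (\<lambda>(z, t). bump a b z * bump c d t)"
    unfolding smooth2_def using flat_exp_algebra_partials by blast
  have "{p. (case p of (z, t) \<Rightarrow> bump a b z * bump c d t) \<noteq> 0} \<subseteq> cbox (a, c) (b, d)"
  proof (clarsimp simp: cbox_Pair_eq)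
    fix z t assume "bump a b z \<noteq> 0" "bump c d t \<noteq> 0"
    then show "a \<le> z \<and> z \<le> b \<and> c \<le> t \<and> t \<le> d"
      by (auto simp: bump_def flat_exp_def split: if_splits)
  qed
  then have "bounded {p. (case p of (z, t) \<Rightarrow> bump a b z * bump c d t) \<noteq> 0}"
    by (rule bounded_subset[OF bounded_cbox])
  then show "compact (tsupport (\<lambda>(z, t). bump a b z * bump c d t))"
    by (simp add: tsupport_def compact_eq_bounded_closed bounded_closure)
next
  fix p :: "real \<times> real"
  have "((\<lambda>p. bump a b (fst p)) has_derivative (\<lambda>h. bump' a b (fst p) * fst h)) (at p)"
    by (rule has_derivative_compose[OF has_derivative_fst[OF has_derivative_ident]])
       (use bump_deriv in \<open>simp add: has_field_derivative_def\<close>)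
  moreover have "((\<lambda>p. bump c d (snd p)) has_derivative (\<lambda>h. bump' c d (snd p) * snd h)) (at p)"
    by (rule has_derivative_compose[OF has_derivative_snd[OF has_derivative_ident]])
       (use bump_deriv in \<open>simp add: has_field_derivative_def\<close>)
  ultimately show "((\<lambda>(z, t). bump a b z * bump c d t) has_derivative
      (\<lambda>(dz, dt). (case p of (z, t) \<Rightarrow> bump' a b z * bump c d t) * dz
        + (case p of (z, t) \<Rightarrow> bump a b z * bump' c d t) * dt)) (at p)"
    by (auto intro!: derivative_eq_intros simp: case_prod_unfold algebra_simps)
qed

subsection \<open>Testing the weak formulation with bumps\<close>

lemma integral_continuous_supported:
  fixes f :: "real \<Rightarrow> real"
  assumes f: "continuous_on {a..b} f" and z: "\<And>x. x < a \<or> b < x \<Longrightarrow> f x = 0"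
  shows "integrable lborel f" "(LINT x|lborel. f x) = integral {a..b} f"
proof -
  have e: "f = (\<lambda>x. indicator {a..b} x *\<^sub>R f x)"
    using z by (force simp: indicator_def fun_eq_iff)
  have si: "set_integrable lborel {a..b} f"
    by (rule borel_integrable_atLeastAtMost'[OF f])
  then show "integrable lborel f"
    unfolding set_integrable_def using e by simp
  have "(LINT x|lborel. f x) = (LINT x:{a..b}|lborel. f x)"
    unfolding set_lebesgue_integral_def using e by simp
  also have "\<dots> = integral {a..b} f"
    by (rule set_borel_integral_eq_integral(2)[OF si])
  finally show "(LINT x|lborel. f x) = integral {a..b} f" .
qed

lemma integral_deriv_supported:
  fixes F f :: "real \<Rightarrow> real"
  assumes ab: "a \<le> b" and F: "\<And>x. (F has_real_derivative f x) (at x)" and f: "continuous_on UNIV f"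
    and z: "\<And>x. x \<le> a \<or> b \<le> x \<Longrightarrow> F x = 0" "\<And>x. x \<le> a \<or> b \<le> x \<Longrightarrow> f x = 0"
  shows "integrable lborel f" "(LINT x|lborel. f x) = 0"
proof -
  have f': "continuous_on {a..b} f" using f continuous_on_subset by blast
  show "integrable lborel f"
    by (rule integral_continuous_supported[OF f']) (use z in auto)
  have "(f has_integral (F b - F a)) {a..b}"
    using ab F by (intro fundamental_theorem_of_calculus)
      (auto simp: has_real_derivative_iff_has_vector_derivative[symmetric] intro: has_field_derivative_at_within)
  moreover have "(LINT x|lborel. f x) = integral {a..b} f"
    by (rule integral_continuous_supported[OF f']) (use z in auto)
  ultimately show "(LINT x|lborel. f x) = 0"
    using z(1)[of a] z(1)[of b] by (simp add: integral_unique)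
qed

lemma bump_mult_integrable:
  assumes "continuous_on UNIV f"
  shows "integrable lborel (\<lambda>x. f x * bump a b x)"
  by (rule integral_continuous_supported[of a b])
     (auto intro!: continuous_intros continuous_on_bump continuous_on_subset[OF assms] simp: bump_eq_0)

lemma bump_mult_integral_diff_bound:
  assumes f: "continuous_on UNIV f" and g: "continuous_on UNIV g"
    and c: "\<And>x. a \<le> x \<Longrightarrow> x \<le> b \<Longrightarrow> \<bar>f x - g x\<bar> \<le> c"
  shows "\<bar>(LINT x|lborel. f x * bump a b x) - (LINT x|lborel. g x * bump a b x)\<bar> \<le> c * (LINT x|lborel. bump a b x)"
proof -
  have "(LINT x|lborel. f x * bump a b x) - (LINT x|lborel. g x * bump a b x)
      = (LINT x|lborel. f x * bump a b x - g x * bump a b x)"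
    by (intro Bochner_Integration.integral_diff[symmetric] bump_mult_integrable f g)
  also have "\<bar>\<dots>\<bar> \<le> (LINT x|lborel. c * bump a b x)"
  proof (rule integral_abs_bound_integral)
    show "integrable lborel (\<lambda>x. f x * bump a b x - g x * bump a b x)"
      by (intro Bochner_Integration.integrable_diff bump_mult_integrable f g)
    show "integrable lborel (\<lambda>x. c * bump a b x)"
      by (intro bump_mult_integrable) auto
    show "\<bar>f x * bump a b x - g x * bump a b x\<bar> \<le> c * bump a b x" for x
    proof (cases "a \<le> x \<and> x \<le> b")
      case True
      then show ?thesis
        using mult_right_mono[OF c bump_nonneg[of a b x], of x] bump_nonneg[of a b x]
        by (simp add: abs_mult flip: left_diff_distrib)
    qed (auto simp: bump_eq_0)
  qed
  finally show ?thesis by simp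
qed

lemma integral_bump_pos:
  assumes "a < b" shows "0 < (LINT x|lborel. bump a b x)"
proof -
  have "(LINT x|lborel. bump a b x) = integral {a..b} (bump a b)"
    by (rule integral_continuous_supported) (auto simp: bump_eq_0 continuous_on_bump)
  moreover have "integral {a..b} (bump a b) \<noteq> 0"
  proof
    assume "integral {a..b} (bump a b) = 0"
    then have "bump a b ((a + b) / 2) = 0"
      using integral_eq_0_iff[OF continuous_on_bump assms, of a b] bump_nonneg assms by auto
    then show False using bump_pos[of a "(a + b) / 2" b] assms by simp
  qed
  moreover have "0 \<le> integral {a..b} (bump a b)"
    by (intro integral_nonneg integrable_continuous_real continuous_on_bump) (auto intro: bump_nonneg)
  ultimately show ?thesis by linarith
qed

text \<open>The sum distance keeps the increments in \<open>z\<close> and \<open>t\<close> apart, so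
  bounds at a fixed time or a fixed position are read off directly. Only times
  \<open>t \<ge> 0\<close> are constrained, where the hypotheses on \<open>w\<close> live.\<close>

definition space_time_lipschitz :: "real \<Rightarrow> (real \<Rightarrow> real \<Rightarrow> real) \<Rightarrow> bool" where
  "space_time_lipschitz C f \<longleftrightarrow> 0 \<le> C \<and>
     (\<forall>z z' t t'. 0 \<le> t \<longrightarrow> 0 \<le> t' \<longrightarrow> \<bar>f z t - f z' t'\<bar> \<le> C * (\<bar>z - z'\<bar> + \<bar>t - t'\<bar>))"

lemma space_time_lipschitzD:
  assumes "space_time_lipschitz C f" "0 \<le> t" "0 \<le> t'"
  shows "\<bar>f z t - f z' t'\<bar> \<le> C * (\<bar>z - z'\<bar> + \<bar>t - t'\<bar>)"
  using assms by (auto simp: space_time_lipschitz_def)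

lemma space_time_lipschitz_continuous:
  assumes "space_time_lipschitz C f"
  shows "continuous_on (UNIV \<times> {0..}) (\<lambda>(z, t). f z t)"
proof -
  have C: "0 \<le> C" using assms by (simp add: space_time_lipschitz_def)
  have "(2 * C)-lipschitz_on (UNIV \<times> {0..}) (\<lambda>(z, t). f z t)"
  proof (rule lipschitz_onI)
    fix p q :: "real \<times> real" assume "p \<in> UNIV \<times> {0..}" "q \<in> UNIV \<times> {0..}"
    then have "\<bar>f (fst p) (snd p) - f (fst q) (snd q)\<bar> \<le> C * (\<bar>fst p - fst q\<bar> + \<bar>snd p - snd q\<bar>)"
      using space_time_lipschitzD[OF assms] by auto
    also have "\<dots> \<le> C * (dist p q + dist p q)"
      using dist_fst_le[of p q] dist_snd_le[of p q] C
      by (intro mult_left_mono add_mono) (auto simp: dist_real_def)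
    finally show "dist (case p of (z, t) \<Rightarrow> f z t) (case q of (z, t) \<Rightarrow> f z t) \<le> 2 * C * dist p q"
      by (simp add: case_prod_unfold dist_real_def)
  qed (use C in auto)
  then show ?thesis by (rule lipschitz_on_continuous_on)
qed

lemma space_time_lipschitz_continuous_space:
  assumes "space_time_lipschitz C f" "0 \<le> t"
  shows "continuous_on UNIV (\<lambda>z. f z t)"
  using continuous_on_compose2[OF space_time_lipschitz_continuous[OF assms(1)]
      continuous_on_Pair[OF continuous_on_id continuous_on_const], of t UNIV] assms(2)
  by (simp add: image_subset_iff)

context decreasing_kernel
begin

text \<open>The difference of two jumps is one integral against \<open>- k'\<close> of
  \<open>f (z + \<zeta>) t - f (z' + \<zeta>) t'\<close> minus \<open>f z t - f z' t'\<close>. Both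
  obey the Lipschitz bound uniformly in \<zeta>, and the weight has mass \<open>k 0\<close>.\<close>

lemma space_time_lipschitz_jump:
  assumes lip: "space_time_lipschitz C f" and M: "\<And>z t. 0 \<le> t \<Longrightarrow> \<bar>f z t\<bar> \<le> M"
  shows "space_time_lipschitz (2 * C * k 0) (\<lambda>z t. jump (\<lambda>s. f s t) z)"
  unfolding space_time_lipschitz_def
proof (intro conjI allI impI)
  have C: "0 \<le> C" using lip by (simp add: space_time_lipschitz_def)
  then show "0 \<le> 2 * C * k 0" using k_nonneg[of 0] by simp
  fix z z' t t' :: real assume t: "0 \<le> t" "0 \<le> t'"
  note c = space_time_lipschitz_continuous_space[OF lip]
  have "jump (\<lambda>s. f s t) z - jump (\<lambda>s. f s t') z'
      = (LINT \<zeta>:{0..}|lborel. - k' \<zeta> * (f (z + \<zeta>) t - f z t) - - k' \<zeta> * (f (z' + \<zeta>) t' - f z' t'))"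
    unfolding jump_def
    by (intro set_integral_diff(2)[symmetric] jump_integrable[OF c[OF t(1)] M[OF t(1)]]
        jump_integrable[OF c[OF t(2)] M[OF t(2)]])
  also have "\<dots> = (LINT \<zeta>:{0..}|lborel. - k' \<zeta> * ((f (z + \<zeta>) t - f (z' + \<zeta>) t') - (f z t - f z' t')))"
    by (rule set_lebesgue_integral_cong) (auto simp: algebra_simps)
  also have "\<bar>\<dots>\<bar> \<le> (2 * C * (\<bar>z - z'\<bar> + \<bar>t - t'\<bar>)) * k 0"
  proof (rule k'_mult_integral_bound)
    show "continuous_on {0..} (\<lambda>\<zeta>. (f (z + \<zeta>) t - f (z' + \<zeta>) t') - (f z t - f z' t'))"
      by (intro continuous_intros continuous_on_compose2[OF c[OF t(1)]] continuous_on_compose2[OF c[OF t(2)]]) auto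
    show "\<bar>(f (z + \<zeta>) t - f (z' + \<zeta>) t') - (f z t - f z' t')\<bar> \<le> 2 * C * (\<bar>z - z'\<bar> + \<bar>t - t'\<bar>)" for \<zeta>
      using space_time_lipschitzD[OF lip t, of "z + \<zeta>" "z' + \<zeta>"] space_time_lipschitzD[OF lip t, of z z'] by simp
  qed
  finally show "\<bar>jump (\<lambda>s. f s t) z - jump (\<lambda>s. f s t') z'\<bar> \<le> 2 * C * k 0 * (\<bar>z - z'\<bar> + \<bar>t - t'\<bar>)"
    by (simp add: mult_ac)
qed

lemma space_time_lipschitz_kernel_integral_deriv:
  assumes lip: "space_time_lipschitz C f" and M: "\<And>z t. 0 \<le> t \<Longrightarrow> \<bar>f z t\<bar> \<le> M" and t: "0 \<le> t"
  shows "((\<lambda>z. LINT \<zeta>:{0..}|lborel. k \<zeta> * f (z + \<zeta>) t) has_real_derivative jump (\<lambda>s. f s t) z) (at z)"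
  by (rule has_derivative_kernel_integral[where C = C and M = M])
     (use space_time_lipschitzD[OF lip t t] M t in auto)

text \<open>The bump in \<open>t\<close> vanishes at \<open>t = 0\<close>, so the initial datum drops out of the weak formulation.\<close>

lemma weak_solution_averages_deriv:
  assumes w: "space_time_lipschitz L w"
    and h: "space_time_lipschitz C h" and M: "\<And>z t. 0 \<le> t \<Longrightarrow> \<bar>h z t\<bar> \<le> M"
    and weak: "\<And>T \<phi> \<phi>z \<phi>t. 0 < T \<Longrightarrow> test_fun \<phi> \<phi>z \<phi>t \<Longrightarrow>
      (LINT t:{0..T}|lborel. LINT z|lborel.
         w z t * \<phi>t (z, t) - (LINT \<zeta>:{0..}|lborel. k \<zeta> * h (z + \<zeta>) t) * \<phi>z (z, t))
      = (LINT z|lborel. w z T * \<phi> (z, T) - w0 z * \<phi> (z, 0))"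
    and ab: "a < b" and T: "0 < T"
  shows "((\<lambda>t. LINT z|lborel. w z t * bump a b z) has_real_derivative
     (LINT z|lborel. jump (\<lambda>s. h s T) z * bump a b z)) (at T)"
proof -
  define N where "N = (\<lambda>z t. LINT \<zeta>:{0..}|lborel. k \<zeta> * h (z + \<zeta>) t)"
  define J where "J = (\<lambda>z t. jump (\<lambda>s. h s t) z)"
  define m where "m = (\<lambda>t. LINT z|lborel. w z t * bump a b z)"
  define g where "g = (\<lambda>t. LINT z|lborel. J z t * bump a b z)"
  \<comment> \<open>Any endpoint beyond \<open>T\<close> would do: the time bump is then positive
    near \<open>T\<close> and can be divided out.\<close>
  define K where "K = T + 1"
  have J: "space_time_lipschitz (2 * C * k 0) J"
    unfolding J_def by (rule space_time_lipschitz_jump[OF h M])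
  have N: "((\<lambda>z. N z t) has_real_derivative J z t) (at z)" if "0 \<le> t" for z t
    unfolding N_def J_def by (rule space_time_lipschitz_kernel_integral_deriv[OF h M that])
  have Nc: "continuous_on UNIV (\<lambda>z. N z t)" if "0 \<le> t" for t
    using N[OF that] by (intro DERIV_continuous_on) auto
  note Jc = space_time_lipschitz_continuous_space[OF J]
  note wc = space_time_lipschitz_continuous_space[OF w]
  have avg_cont: "continuous_on {0..} (\<lambda>t. LINT z|lborel. f z t * bump a b z)"
    if f: "space_time_lipschitz B f" for B f
  proof -
    let ?P = "LINT x|lborel. bump a b x"
    have "(B * ?P)-lipschitz_on {0..} (\<lambda>t. LINT z|lborel. f z t * bump a b z)"
    proof (rule lipschitz_onI)
      fix t t' :: real assume t: "t \<in> {0..}" "t' \<in> {0..}"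
      have "\<bar>(LINT z|lborel. f z t * bump a b z) - (LINT z|lborel. f z t' * bump a b z)\<bar> \<le> (B * \<bar>t - t'\<bar>) * ?P"
        using t space_time_lipschitzD[OF f, of t t'] space_time_lipschitz_continuous_space[OF f]
        by (intro bump_mult_integral_diff_bound) (auto, metis abs_zero add_0 diff_self)
      then show "dist (LINT z|lborel. f z t * bump a b z) (LINT z|lborel. f z t' * bump a b z) \<le> B * ?P * dist t t'"
        by (simp add: dist_real_def mult_ac)
    next
      show "0 \<le> B * ?P"
        using f integral_bump_pos[OF ab] by (simp add: space_time_lipschitz_def)
    qed
    then show ?thesis by (rule lipschitz_on_continuous_on)
  qed
  \<comment> \<open>Integration by parts in \<open>z\<close> at a fixed time:
    \<open>N * bump'\<close> differs from \<open>- J * bump\<close> by the derivative of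
    \<open>N * bump\<close>, whose integral is zero.\<close>
  have inner: "(LINT z|lborel. w z t * (bump a b z * bump' 0 K t) - N z t * (bump' a b z * bump 0 K t))
      = bump' 0 K t * m t + bump 0 K t * g t" if t: "0 \<le> t" for t
  proof -
    have c: "continuous_on UNIV (\<lambda>z. J z t * bump a b z + N z t * bump' a b z)"
      by (intro continuous_intros Jc[OF t] Nc[OF t] continuous_on_bump continuous_on_bump')
    have parts: "integrable lborel (\<lambda>z. J z t * bump a b z + N z t * bump' a b z)"
      "(LINT z|lborel. J z t * bump a b z + N z t * bump' a b z) = 0"
      by (rule integral_deriv_supported[where F = "\<lambda>z. N z t * bump a b z" and a = a and b = b];
          use ab c N[OF t] bump_deriv in \<open>auto intro!: derivative_eq_intros simp: bump_eq_0 bump'_eq_0\<close>)+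
    have i1: "integrable lborel (\<lambda>z. w z t * bump a b z)"
      and i2: "integrable lborel (\<lambda>z. J z t * bump a b z)"
      by (intro bump_mult_integrable wc[OF t] Jc[OF t])+
    have "(LINT z|lborel. w z t * (bump a b z * bump' 0 K t) - N z t * (bump' a b z * bump 0 K t))
        = (LINT z|lborel. bump' 0 K t * (w z t * bump a b z) + bump 0 K t * (J z t * bump a b z)
            - bump 0 K t * (J z t * bump a b z + N z t * bump' a b z))"
      by (intro Bochner_Integration.integral_cong) (auto simp: algebra_simps)
    also have "\<dots> = bump' 0 K t * m t + bump 0 K t * g t"
      using i1 i2 parts by (simp add: m_def g_def)
    finally show ?thesis .
  qed
  \<comment> \<open>The upper end \<open>s\<close> of the time interval varies while the test
    function is kept, so the identity gives \<open>m\<close> at every time in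
    \<open>{0<..<K}\<close>.\<close>
  have id: "bump 0 K s * m s = integral {0..s} (\<lambda>t. bump' 0 K t * m t + bump 0 K t * g t)" if "0 < s" for s
  proof -
    have "bump 0 K s * m s = (LINT z|lborel. w z s * (bump a b z * bump 0 K s) - w0 z * (bump a b z * bump 0 K 0))"
      by (simp add: bump_eq_0 m_def mult_ac flip: integral_mult_right_zero)
    also have "\<dots> = (LINT t:{0..s}|lborel. LINT z|lborel.
        w z t * (bump a b z * bump' 0 K t) - N z t * (bump' a b z * bump 0 K t))"
      using weak[OF that test_fun_bump[of a b 0 K]] by (simp add: N_def)
    also have "\<dots> = (LINT t:{0..s}|lborel. bump' 0 K t * m t + bump 0 K t * g t)"
      by (rule set_lebesgue_integral_cong) (auto simp: inner)
    also have "\<dots> = integral {0..s} (\<lambda>t. bump' 0 K t * m t + bump 0 K t * g t)"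
      unfolding m_def g_def
      by (intro set_borel_integral_eq_integral(2) borel_integrable_atLeastAtMost' continuous_intros
          continuous_on_bump continuous_on_bump' continuous_on_subset[OF avg_cont[OF w]] continuous_on_subset[OF avg_cont[OF J]])
        auto
    finally show ?thesis .
  qed
  have "((\<lambda>s. integral {0..s} (\<lambda>t. bump' 0 K t * m t + bump 0 K t * g t)) has_real_derivative
      bump' 0 K T * m T + bump 0 K T * g T) (at T within {0..K})"
    unfolding m_def g_def
    by (rule integral_has_real_derivative, intro continuous_intros
          continuous_on_bump continuous_on_bump' continuous_on_subset[OF avg_cont[OF w]] continuous_on_subset[OF avg_cont[OF J]])
       (use T in \<open>auto simp: K_def\<close>)
  then have "((\<lambda>s. integral {0..s} (\<lambda>t. bump' 0 K t * m t + bump 0 K t * g t)) has_real_derivative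
      bump' 0 K T * m T + bump 0 K T * g T) (at T)"
    using T at_within_Icc_at[of 0 T K] by (simp add: K_def)
  then have Q: "((\<lambda>s. integral {0..s} (\<lambda>t. bump' 0 K t * m t + bump 0 K t * g t) / bump 0 K s) has_real_derivative
      ((bump' 0 K T * m T + bump 0 K T * g T) * bump 0 K T
       - integral {0..T} (\<lambda>t. bump' 0 K t * m t + bump 0 K t * g t) * bump' 0 K T) / (bump 0 K T * bump 0 K T)) (at T)"
    using bump_deriv bump_pos[of 0 T K] T by (intro DERIV_divide) (auto simp: K_def)
  \<comment> \<open>By \<open>id\<close> the integral at \<open>T\<close> equals
    \<open>bump 0 K T * m T\<close>, so the terms with \<open>bump'\<close> cancel in the quotient
    rule and only \<open>g T\<close> is left.\<close>
  have "((\<lambda>s. integral {0..s} (\<lambda>t. bump' 0 K t * m t + bump 0 K t * g t) / bump 0 K s) has_real_derivative g T) (at T)"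
    by (rule DERIV_cong[OF Q]) (use id[OF T] bump_pos[of 0 T K] T in \<open>simp add: K_def field_simps flip: id\<close>)
  then have "(m has_real_derivative g T) (at T)"
  proof (rule DERIV_cong_ev[THEN iffD1, OF refl _ refl, rotated])
    have "\<forall>\<^sub>F s in nhds T. s \<in> {0<..<K}"
      using T by (intro eventually_nhds_in_open) (auto simp: K_def)
    then show "\<forall>\<^sub>F s in nhds T. integral {0..s} (\<lambda>t. bump' 0 K t * m t + bump 0 K t * g t) / bump 0 K s = m s"
    proof eventually_elim
      case (elim s)
      then show ?case
        using id[of s, symmetric] bump_pos[of 0 s K] by simp
    qed
  qed
  then show ?thesis
    by (simp add: m_def g_def J_def)
qed

text \<open>A bump of half-width \<epsilon> around \<open>z\<close> gives averages with
  \<open>m t - m s = (t - s) * g \<tau>\<close>, and for small \<epsilon> the averages divided by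
  the mass of the bump approach point values. The time \<tau> moves with \<epsilon>, but
  \<open>J\<close> is Lipschitz in time, so replacing \<tau> by a fixed \<open>r\<close> costs at
  most \<open>B * (t - s)\<^sup>2\<close>, an error that a derivative tolerates.\<close>

lemma weak_solution_pointwise_deriv:
  assumes w: "space_time_lipschitz L w"
    and h: "space_time_lipschitz C h" and M: "\<And>z t. 0 \<le> t \<Longrightarrow> \<bar>h z t\<bar> \<le> M"
    and weak: "\<And>T \<phi> \<phi>z \<phi>t. 0 < T \<Longrightarrow> test_fun \<phi> \<phi>z \<phi>t \<Longrightarrow>
      (LINT t:{0..T}|lborel. LINT z|lborel.
         w z t * \<phi>t (z, t) - (LINT \<zeta>:{0..}|lborel. k \<zeta> * h (z + \<zeta>) t) * \<phi>z (z, t))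
      = (LINT z|lborel. w z T * \<phi> (z, T) - w0 z * \<phi> (z, 0))"
    and T: "0 < T"
  shows "((\<lambda>t. w z t) has_real_derivative jump (\<lambda>s. h s T) z) (at T)"
proof -
  define J where "J = (\<lambda>z t. jump (\<lambda>s. h s t) z)"
  define B where "B = 2 * C * k 0"
  have J: "space_time_lipschitz B J"
    unfolding J_def B_def by (rule space_time_lipschitz_jump[OF h M])
  have B: "0 \<le> B" using J by (simp add: space_time_lipschitz_def)
  \<comment> \<open>\<open>r\<close> ranges over all of \<open>{s..t}\<close>: its right end serves
    difference quotients from the left, its left end those from the right.\<close>
  have bound: "\<bar>w z t - w z s - (t - s) * J z r\<bar> \<le> B * (t - s)\<^sup>2"
    if s: "0 < s" "s < t" and r: "s \<le> r" "r \<le> t" for s t r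
  proof (rule field_le_epsilon)
    fix e :: real assume e: "0 < e"
    \<comment> \<open>\<open>\<epsilon> * A\<close> is the total error after division by the mass
      \<open>P\<close>: \<open>L * \<epsilon>\<close> at each of the two times and
      \<open>(t - s) * B * \<epsilon>\<close> from \<open>J\<close>. The \<open>+ 1\<close> in the
      definition of \<epsilon> guards against \<open>A = 0\<close>.\<close>
    define A where "A = 2 * L + (t - s) * B"
    have A: "0 \<le> A"
      using w B s by (simp add: A_def space_time_lipschitz_def)
    define \<epsilon> where "\<epsilon> = e / (A + 1)"
    have \<epsilon>: "0 < \<epsilon>" and \<epsilon>A: "\<epsilon> * A \<le> e"
      using A e by (auto simp: \<epsilon>_def field_simps)
    let ?b = "bump (z - \<epsilon>) (z + \<epsilon>)"
    define P where "P = (LINT x|lborel. ?b x)"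
    define m where "m = (\<lambda>t. LINT x|lborel. w x t * ?b x)"
    define g where "g = (\<lambda>t. LINT x|lborel. J x t * ?b x)"
    have P: "0 < P" using integral_bump_pos \<epsilon> by (simp add: P_def)
    have "(m has_real_derivative g \<tau>) (at \<tau>)" if "0 < \<tau>" for \<tau>
      unfolding m_def g_def J_def
      by (rule weak_solution_averages_deriv[OF w h M weak]) (use \<epsilon> that in auto)
    then obtain \<tau> where \<tau>: "s < \<tau>" "\<tau> < t" "m t - m s = (t - s) * g \<tau>"
      using MVT2[of s t m g] s by auto
    have close: "\<bar>(LINT x|lborel. f x q * ?b x) - P * f z q\<bar> \<le> D * \<epsilon> * P"
      if f: "space_time_lipschitz D f" and q: "0 \<le> q" for f D q
    proof -
      have "\<bar>f x q - f z q\<bar> \<le> D * \<epsilon>" if "z - \<epsilon> \<le> x" "x \<le> z + \<epsilon>" for x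
      proof -
        have "\<bar>f x q - f z q\<bar> \<le> D * \<bar>x - z\<bar>"
          using space_time_lipschitzD[OF f q q, of x z] by simp
        also have "\<dots> \<le> D * \<epsilon>"
          using that f by (intro mult_left_mono) (auto simp: space_time_lipschitz_def)
        finally show ?thesis .
      qed
      then have "\<bar>(LINT x|lborel. f x q * ?b x) - (LINT x|lborel. f z q * ?b x)\<bar> \<le> D * \<epsilon> * P"
        unfolding P_def
        by (intro bump_mult_integral_diff_bound space_time_lipschitz_continuous_space[OF f q]) auto
      then show ?thesis by (simp add: P_def mult.commute)
    qed
    have "\<bar>m t - P * w z t\<bar> \<le> L * \<epsilon> * P" "\<bar>m s - P * w z s\<bar> \<le> L * \<epsilon> * P"
      unfolding m_def using close[OF w] s by auto
    moreover have "\<bar>(t - s) * (g \<tau> - P * J z \<tau>)\<bar> \<le> (t - s) * (B * \<epsilon> * P)"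
      using close[OF J, of \<tau>] s \<tau> by (auto simp: abs_mult g_def intro!: mult_left_mono)
    moreover have "P * (w z t - w z s - (t - s) * J z \<tau>)
        = - (m t - P * w z t) + (m s - P * w z s) + (t - s) * (g \<tau> - P * J z \<tau>)"
      using \<tau>(3) by (simp add: algebra_simps)
    ultimately have "\<bar>P * (w z t - w z s - (t - s) * J z \<tau>)\<bar>
        \<le> L * \<epsilon> * P + L * \<epsilon> * P + (t - s) * (B * \<epsilon> * P)"
      by linarith
    also have "\<dots> = P * (\<epsilon> * A)"
      by (simp add: A_def algebra_simps)
    finally have "P * \<bar>w z t - w z s - (t - s) * J z \<tau>\<bar> \<le> P * (\<epsilon> * A)"
      using P by (simp add: abs_mult)
    then have 1: "\<bar>w z t - w z s - (t - s) * J z \<tau>\<bar> \<le> e"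
      using P \<epsilon>A by simp
    have "\<bar>J z \<tau> - J z r\<bar> \<le> B * \<bar>\<tau> - r\<bar>"
      using space_time_lipschitzD[OF J, of \<tau> r z z] s r \<tau> by simp
    also have "\<dots> \<le> B * (t - s)"
      using B r \<tau> by (intro mult_left_mono) auto
    finally have "\<bar>(t - s) * (J z \<tau> - J z r)\<bar> \<le> (t - s) * (B * (t - s))"
      using s by (simp add: abs_mult)
    then have 2: "\<bar>(t - s) * (J z \<tau> - J z r)\<bar> \<le> B * (t - s)\<^sup>2"
      by (simp add: power2_eq_square mult_ac)
    have "w z t - w z s - (t - s) * J z r
        = (w z t - w z s - (t - s) * J z \<tau>) + (t - s) * (J z \<tau> - J z r)"
      by (simp add: algebra_simps)
    then show "\<bar>w z t - w z s - (t - s) * J z r\<bar> \<le> B * (t - s)\<^sup>2 + e"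
      using 1 2 by linarith
  qed
  have "((\<lambda>t. w z t) has_real_derivative J z T) (at T)"
  \<comment> \<open>The radius is \<open>T\<close> itself, so only positive times \<open>y\<close>
    are compared.\<close>
  proof (rule has_real_derivative_quadratic_bound[OF T])
    fix y assume y: "\<bar>y - T\<bar> < T"
    show "\<bar>w z y - w z T - (y - T) * J z T\<bar> \<le> B * (y - T)\<^sup>2"
    proof (cases y T rule: linorder_cases)
      case less
      have "\<bar>w z y - w z T - (y - T) * J z T\<bar> = \<bar>w z T - w z y - (T - y) * J z T\<bar>"
        by (simp add: algebra_simps abs_if)
      also have "\<dots> \<le> B * (T - y)\<^sup>2"
        using bound[of y T T] less y by simp
      finally show ?thesis by (simp add: power2_commute)
    next
      case greater
      then show ?thesis using bound[of T y T] T by simp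
    qed simp
  qed
  then show ?thesis by (simp add: J_def)
qed

end

subsection \<open>From pointwise to distributional balance\<close>

lemma test_fun_has_derivative:
  "test_fun \<phi> \<phi>z \<phi>t \<Longrightarrow> (\<phi> has_derivative (\<lambda>(dz, dt). \<phi>z p * dz + \<phi>t p * dt)) (at p)"
  unfolding test_fun_def by blast

text \<open>\<open>test_fun\<close> ties the partials to \<open>\<phi>\<close> only through its
  derivative. Uniqueness of the derivative identifies them with members of the family witnessing
  \<open>smooth2\<close>, and every member is differentiable, hence continuous.\<close>

lemma test_fun_partials_continuous:
  assumes "test_fun \<phi> \<phi>z \<phi>t"
  shows "continuous_on UNIV \<phi>" "continuous_on UNIV \<phi>z" "continuous_on UNIV \<phi>t"
proof -
  note d = test_fun_has_derivative[OF assms]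
  obtain S where S: "\<phi> \<in> S" "\<And>g. g \<in> S \<Longrightarrow> \<exists>gz\<in>S. \<exists>gt\<in>S. \<forall>p.
      (g has_derivative (\<lambda>(dz, dt). gz p * dz + gt p * dt)) (at p)"
    using assms unfolding test_fun_def smooth2_def by blast
  have c: "continuous_on UNIV g" if gS: "g \<in> S" for g
  proof -
    obtain gz gt where "\<And>p. (g has_derivative (\<lambda>(dz, dt). gz p * dz + gt p * dt)) (at p)"
      using S(2)[OF gS] by blast
    then show ?thesis
      by (intro has_derivative_continuous_on[where f' = "\<lambda>p (dz, dt). gz p * dz + gt p * dt"]) auto
  qed
  obtain gz gt where g: "gz \<in> S" "gt \<in> S"
    "\<And>p. (\<phi> has_derivative (\<lambda>(dz, dt). gz p * dz + gt p * dt)) (at p)"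
    using S by blast
  have e: "(\<lambda>(dz, dt). \<phi>z p * dz + \<phi>t p * dt) = (\<lambda>(dz, dt). gz p * dz + gt p * dt)" for p
    by (rule has_derivative_unique[OF d g(3)])
  have "\<phi>z = gz" "\<phi>t = gt"
    using fun_cong[OF e, where x = "(1, 0)"] fun_cong[OF e, where x = "(0, 1)"] by (auto simp: fun_eq_iff)
  then show "continuous_on UNIV \<phi>" "continuous_on UNIV \<phi>z" "continuous_on UNIV \<phi>t"
    using c S(1) g by auto
qed

lemma test_fun_partials:
  assumes "test_fun \<phi> \<phi>z \<phi>t"
  shows "((\<lambda>z. \<phi> (z, t)) has_real_derivative \<phi>z (z, t)) (at z)"
    and "((\<lambda>t. \<phi> (z, t)) has_real_derivative \<phi>t (z, t)) (at t)"
proof -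
  note d = test_fun_has_derivative[OF assms]
  have "((\<lambda>z. (z, t)) has_derivative (\<lambda>h. (h, 0))) (at z)" "((\<lambda>t. (z, t)) has_derivative (\<lambda>h. (0, h))) (at t)"
    by (auto intro!: derivative_eq_intros)
  from this[THEN has_derivative_compose, OF d]
  show "((\<lambda>z. \<phi> (z, t)) has_real_derivative \<phi>z (z, t)) (at z)"
    and "((\<lambda>t. \<phi> (z, t)) has_real_derivative \<phi>t (z, t)) (at t)"
    by (simp_all add: has_field_derivative_def)
qed

text \<open>The complement of \<open>tsupport\<close> is open, so the function vanishes in a whole
  neighbourhood of \<open>p\<close> and its derivative at \<open>p\<close> is zero too.\<close>

lemma test_fun_zero_outside:
  assumes "test_fun \<phi> \<phi>z \<phi>t" "p \<notin> tsupport \<phi>"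
  shows "\<phi> p = 0" "\<phi>z p = 0" "\<phi>t p = 0"
proof -
  have z: "\<phi> q = 0" if "q \<notin> tsupport \<phi>" for q
    using that closure_subset[of "{p. \<phi> p \<noteq> 0}"] by (auto simp: tsupport_def)
  then show "\<phi> p = 0" using assms by simp
  have "open (- tsupport \<phi>)" by (simp add: tsupport_def open_Compl)
  then have "(\<phi> has_derivative (\<lambda>h. 0)) (at p)"
    by (rule has_derivative_transform_within_open[OF has_derivative_const[of 0]]) (use assms z in auto)
  moreover note test_fun_has_derivative[OF assms(1), of p]
  ultimately have e: "(\<lambda>(dz, dt). \<phi>z p * dz + \<phi>t p * dt) = (\<lambda>h. 0)"
    by (metis has_derivative_unique)
  show "\<phi>z p = 0" "\<phi>t p = 0"
    using fun_cong[OF e, of "(1, 0)"] fun_cong[OF e, of "(0, 1)"] by auto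
qed

lemma test_fun_support_box:
  assumes "test_fun \<phi> \<phi>z \<phi>t" "tsupport \<phi> \<subseteq> UNIV \<times> {0<..}"
  obtains \<tau> R where "0 < \<tau>" "\<tau> < R" "tsupport \<phi> \<subseteq> {-R<..<R} \<times> {\<tau><..<R}"
proof -
  have cpt: "compact (tsupport \<phi>)" using assms by (simp add: test_fun_def)
  obtain \<tau> where \<tau>: "0 < \<tau>" "\<And>p. p \<in> tsupport \<phi> \<Longrightarrow> \<tau> < snd p"
  proof (cases "tsupport \<phi> = {}")
    case True
    then show ?thesis using that[of 1] by simp
  next
    case False
    then have "\<exists>q\<in>tsupport \<phi>. \<forall>p\<in>tsupport \<phi>. snd q \<le> snd p"
      by (intro continuous_attains_inf cpt continuous_intros)
    then obtain q where q: "q \<in> tsupport \<phi>" "\<And>p. p \<in> tsupport \<phi> \<Longrightarrow> snd q \<le> snd p"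
      by blast
    then have "0 < snd q" using assms(2) by auto
    then show ?thesis using that[of "snd q / 2"] q by force
  qed
  obtain R where R: "\<And>p. p \<in> tsupport \<phi> \<Longrightarrow> norm p \<le> R"
    using compact_imp_bounded[OF cpt] by (auto simp: bounded_iff)
  \<comment> \<open>The enlarged radius makes the inclusions strict and exceeds \<tau>, even if the
    support is empty and \<open>R\<close> negative.\<close>
  have "tsupport \<phi> \<subseteq> {-(\<bar>R\<bar> + \<tau> + 1)<..<\<bar>R\<bar> + \<tau> + 1} \<times> {\<tau><..<\<bar>R\<bar> + \<tau> + 1}"
  proof
    fix p assume p: "p \<in> tsupport \<phi>"
    have "\<bar>fst p\<bar> \<le> R" "\<bar>snd p\<bar> \<le> R"
      using norm_fst_le[of "fst p" "snd p"] norm_snd_le[of "snd p" "fst p"] R[OF p] by auto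
    then show "p \<in> {-(\<bar>R\<bar> + \<tau> + 1)<..<\<bar>R\<bar> + \<tau> + 1} \<times> {\<tau><..<\<bar>R\<bar> + \<tau> + 1}"
      using \<tau>(1) \<tau>(2)[OF p] by (cases p) auto
  qed
  with that[of \<tau> "\<bar>R\<bar> + \<tau> + 1"] \<tau>(1) show ?thesis by auto
qed

text \<open>The integrand is \<open>\<partial>\<^sub>t (U \<phi>) - \<partial>\<^sub>z (N \<phi>)\<close>; the second term already integrates to
  zero in \<open>z\<close>, the first one after exchanging the order of integration.\<close>

lemma pointwise_balance_imp_distributional:
  assumes U: "\<And>z t. 0 < t \<Longrightarrow> ((\<lambda>s. U z s) has_real_derivative Ut z t) (at t)"
    and Uc: "continuous_on (UNIV \<times> {0<..}) (\<lambda>(z, t). U z t)"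
    and Utc: "continuous_on (UNIV \<times> {0<..}) (\<lambda>(z, t). Ut z t)"
    and N: "\<And>z t. 0 < t \<Longrightarrow> ((\<lambda>y. N y t) has_real_derivative Nz z t) (at z)"
    and Nzc: "\<And>t. 0 < t \<Longrightarrow> continuous_on UNIV (\<lambda>z. Nz z t)"
    and balance: "\<And>z t. 0 < t \<Longrightarrow> Ut z t + D z t = Nz z t"
    and \<phi>: "test_fun \<phi> \<phi>z \<phi>t" "tsupport \<phi> \<subseteq> UNIV \<times> {0<..}"
  shows "(LINT t:{0<..}|lborel. LINT z|lborel.
      U z t * \<phi>t (z, t) - D z t * \<phi> (z, t) - N z t * \<phi>z (z, t)) = 0"
proof -
  obtain \<tau> R where \<tau>R: "0 < \<tau>" "\<tau> < R" and box: "tsupport \<phi> \<subseteq> {-R<..<R} \<times> {\<tau><..<R}"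
    using test_fun_support_box[OF \<phi>] .
  have zero: "\<phi> (z, t) = 0" "\<phi>z (z, t) = 0" "\<phi>t (z, t) = 0"
    if "z \<le> -R \<or> R \<le> z \<or> t \<le> \<tau> \<or> R \<le> t" for z t
  proof -
    have "(z, t) \<notin> tsupport \<phi>" using that box by auto
    then show "\<phi> (z, t) = 0" "\<phi>z (z, t) = 0" "\<phi>t (z, t) = 0"
      by (rule test_fun_zero_outside[OF \<phi>(1)])+
  qed
  note \<phi>c = test_fun_partials_continuous[OF \<phi>(1)]
  define E where "E = (\<lambda>z t. Ut z t * \<phi> (z, t) + U z t * \<phi>t (z, t))"
  have Ec: "continuous_on (UNIV \<times> {0<..}) (\<lambda>(z, t). E z t)"
  proof -
    have "continuous_on (UNIV \<times> {0<..}) (\<lambda>p. (case p of (z, t) \<Rightarrow> Ut z t) * \<phi> p + (case p of (z, t) \<Rightarrow> U z t) * \<phi>t p)"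
      by (intro continuous_intros Uc Utc continuous_on_subset[OF \<phi>c(1)] continuous_on_subset[OF \<phi>c(3)]) auto
    then show ?thesis by (simp add: E_def case_prod_unfold)
  qed
  have slice: "continuous_on UNIV (\<lambda>z. f (z, t))" if "continuous_on UNIV f" for f :: "real \<times> real \<Rightarrow> real" and t
    by (rule continuous_on_compose2[OF that]) (auto intro!: continuous_intros)
  have Ecz: "continuous_on S (\<lambda>z. E z t)" if "0 < t" for t S
  proof -
    have "continuous_on S (\<lambda>z. (z, t))" by (intro continuous_intros)
    from continuous_on_compose2[OF Ec this] that show ?thesis by auto
  qed
  have inner: "(LINT z|lborel. U z t * \<phi>t (z, t) - D z t * \<phi> (z, t) - N z t * \<phi>z (z, t))
      = integral {-R..R} (\<lambda>z. E z t)" if t: "0 < t" for t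
  proof -
    have E: "integrable lborel (\<lambda>z. E z t)" "(LINT z|lborel. E z t) = integral {-R..R} (\<lambda>z. E z t)"
      by (rule integral_continuous_supported[of "-R" R]; use Ecz[OF t] zero in \<open>auto simp: E_def\<close>)+
    have "continuous_on UNIV (\<lambda>z. N z t)"
      using N[OF t] by (intro DERIV_continuous_on) auto
    then have c: "continuous_on UNIV (\<lambda>z. Nz z t * \<phi> (z, t) + \<phi>z (z, t) * N z t)"
      by (intro continuous_intros Nzc[OF t] slice \<phi>c)
    have F: "((\<lambda>z. N z t * \<phi> (z, t)) has_real_derivative Nz z t * \<phi> (z, t) + \<phi>z (z, t) * N z t) (at z)" for z
      by (rule DERIV_mult[OF N[OF t] test_fun_partials(1)[OF \<phi>(1)]])
    have flux: "integrable lborel (\<lambda>z. Nz z t * \<phi> (z, t) + \<phi>z (z, t) * N z t)"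
        "(LINT z|lborel. Nz z t * \<phi> (z, t) + \<phi>z (z, t) * N z t) = 0"
      by (rule integral_deriv_supported[OF _ F c, of "-R" R]; use \<tau>R zero in auto)+
    \<comment> \<open>The balance eliminates \<open>D\<close>, so integrability comes from
      \<open>E\<close> and the flux term alone.\<close>
    have eq: "U z t * \<phi>t (z, t) - D z t * \<phi> (z, t) - N z t * \<phi>z (z, t)
        = E z t - (Nz z t * \<phi> (z, t) + \<phi>z (z, t) * N z t)" for z
    proof -
      have D: "D z t = Nz z t - Ut z t" using balance[OF t, of z] by linarith
      show ?thesis unfolding D E_def by (simp add: algebra_simps)
    qed
    show ?thesis
      by (simp only: eq Bochner_Integration.integral_diff[OF E(1) flux(1)] E(2) flux(2) diff_zero)
  qed
  define I where "I = (\<lambda>t. integral {-R..R} (\<lambda>z. E z t))"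
  have Ic: "continuous_on {\<tau>..R} I"
  proof -
    have "continuous_on ({\<tau>..R} \<times> cbox (-R) R) (\<lambda>(t, z). E z t)"
    proof -
      have "continuous_on ({\<tau>..R} \<times> cbox (-R) R) (\<lambda>p. (snd p, fst p))"
        by (intro continuous_intros)
      from continuous_on_compose2[OF Ec this] \<tau>R show ?thesis
        by (simp add: case_prod_unfold image_subset_iff)
    qed
    then show ?thesis
      unfolding I_def using integral_continuous_on_param[of "{\<tau>..R}" "-R" R "\<lambda>t z. E z t"] by simp
  qed
  have "(LINT t:{0<..}|lborel. LINT z|lborel. U z t * \<phi>t (z, t) - D z t * \<phi> (z, t) - N z t * \<phi>z (z, t))
      = (LINT t:{0<..}|lborel. I t)"
    by (rule set_lebesgue_integral_cong) (auto simp: inner I_def)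
  also have "\<dots> = (LINT t:{\<tau>..R}|lborel. I t)"
  proof -
    have "I t = 0" if "t < \<tau> \<or> R < t" for t
      unfolding I_def E_def using zero[where t = t] that by auto
    then show ?thesis
      unfolding set_lebesgue_integral_def using \<tau>R
      by (intro Bochner_Integration.integral_cong) (auto simp: indicator_def not_le)
  qed
  also have "\<dots> = integral {\<tau>..R} I"
    by (intro set_borel_integral_eq_integral(2) borel_integrable_atLeastAtMost' Ic)
  \<comment> \<open>\<open>E\<close> is continuous on the closed box, which stays away from
    \<open>t = 0\<close>, so the order may be exchanged; for fixed \<open>z\<close> the time
    integral is then a boundary term that vanishes.\<close>
  also have "\<dots> = integral {-R..R} (\<lambda>z. integral {\<tau>..R} (E z))"
  proof -
    have "continuous_on (cbox (-R, \<tau>) (R, R)) (\<lambda>(z, t). E z t)"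
      by (rule continuous_on_subset[OF Ec]) (use \<tau>R in \<open>auto simp: cbox_Pair_eq\<close>)
    from integral_swap_continuous[OF this] show ?thesis
      by (simp add: I_def)
  qed
  also have "\<dots> = integral {-R..R} (\<lambda>z. 0)"
  proof (rule Henstock_Kurzweil_Integration.integral_cong)
    fix z
    have "(E z has_integral (U z R * \<phi> (z, R) - U z \<tau> * \<phi> (z, \<tau>))) {\<tau>..R}"
    proof (rule fundamental_theorem_of_calculus)
      fix t assume "t \<in> {\<tau>..R}"
      then have t: "0 < t" using \<tau>R by auto
      have "((\<lambda>t. U z t * \<phi> (z, t)) has_real_derivative E z t) (at t)"
        unfolding E_def
        by (rule DERIV_cong[OF DERIV_mult[OF U[OF t] test_fun_partials(2)[OF \<phi>(1)]]]) (simp add: mult.commute)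
      then show "((\<lambda>t. U z t * \<phi> (z, t)) has_vector_derivative E z t) (at t within {\<tau>..R})"
        by (simp add: has_real_derivative_iff_has_vector_derivative has_vector_derivative_at_within)
    qed (use \<tau>R in simp)
    then show "integral {\<tau>..R} (E z) = 0"
      using zero[of z \<tau>] zero[of z R] by (simp add: integral_unique)
  qed
  finally show ?thesis by simp
qed

subsection \<open>Entropy remainder\<close>

text \<open>The derivative is taken within the interval, hence one-sided at its ends, because an end
  may be the value 1, where \<open>W\<close> and \<open>Q\<close> are controlled only from the
  right.\<close>

lemma increment_nonneg:
  fixes F :: "real \<Rightarrow> real"
  assumes "u \<le> v" "\<And>x. x \<in> {u..v} \<Longrightarrow> (F has_real_derivative f x) (at x within {u..v})"
    and "\<And>x. x \<in> {u..v} \<Longrightarrow> 0 \<le> f x"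
  shows "F u \<le> F v"
proof -
  have "(f has_integral (F v - F u)) {u..v}"
    using assms(1,2) by (intro fundamental_theorem_of_calculus)
      (auto simp: has_real_derivative_iff_has_vector_derivative)
  then have "0 \<le> F v - F u"
    by (rule has_integral_nonneg) (use assms(3) in auto)
  then show ?thesis by simp
qed

context
  fixes W dW Q d\<eta> d2\<eta> :: "real \<Rightarrow> real"
  assumes W: "\<And>x. 1 \<le> x \<Longrightarrow> (W has_real_derivative dW x) (at x within {1..})"
    and Q: "\<And>x. 1 \<le> x \<Longrightarrow> (Q has_real_derivative d\<eta> x * dW x) (at x within {1..})"
begin

text \<open>For \<open>c = d\<eta> a\<close> the derivative is the inner integral over \<mu> of the
  dissipation, so this function is its primitive in \<sigma>. Both the value and the sign of the
  remainder rest on it.\<close>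

lemma entropy_remainder_deriv:
  assumes "1 \<le> x"
  shows "((\<lambda>\<sigma>. Q \<sigma> - c * W \<sigma>) has_real_derivative (d\<eta> x - c) * dW x) (at x within {1..})"
  using W[OF assms] Q[OF assms] by (auto intro!: derivative_eq_intros simp: algebra_simps)

text \<open>Both integrals are oriented, so the formula covers \<open>b < a\<close> as well. Each is
  evaluated by the fundamental theorem, first in \<mu> with \<open>dW \<sigma>\<close> as a constant
  factor.\<close>

lemma entropy_remainder_eq:
  assumes dWc: "continuous_on {1..} dW" and \<eta>: "\<And>x. (d\<eta> has_real_derivative d2\<eta> x) (at x)"
    and d2\<eta>: "continuous_on UNIV d2\<eta>" and ab: "1 \<le> a" "1 \<le> b"
  shows "(LBINT \<sigma>=ereal a..ereal b. (LBINT \<mu>=ereal a..ereal \<sigma>. d2\<eta> \<mu> * dW \<sigma>))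
    = (Q b - Q a) - d\<eta> a * (W b - W a)"
proof -
  have inner: "(LBINT \<mu>=ereal a..ereal \<sigma>. d2\<eta> \<mu> * dW \<sigma>) = (d\<eta> \<sigma> - d\<eta> a) * dW \<sigma>" for \<sigma>
  proof -
    have "(LBINT \<mu>=ereal a..ereal \<sigma>. d2\<eta> \<mu> * dW \<sigma>) = d\<eta> \<sigma> * dW \<sigma> - d\<eta> a * dW \<sigma>"
    proof (rule interval_integral_FTC_finite)
      show "continuous_on {min a \<sigma>..max a \<sigma>} (\<lambda>\<mu>. d2\<eta> \<mu> * dW \<sigma>)"
        by (intro continuous_intros continuous_on_subset[OF d2\<eta>]) auto
      show "((\<lambda>\<mu>. d\<eta> \<mu> * dW \<sigma>) has_vector_derivative d2\<eta> x * dW \<sigma>) (at x within {min a \<sigma>..max a \<sigma>})" for x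
        unfolding has_real_derivative_iff_has_vector_derivative[symmetric]
        by (rule DERIV_cmult_right[OF has_field_derivative_at_within[OF \<eta>]])
    qed
    then show ?thesis by (simp add: left_diff_distrib)
  qed
  have d\<eta>c: "continuous_on UNIV d\<eta>"
    using \<eta> by (intro DERIV_continuous_on) auto
  have sub: "{min a b..max a b} \<subseteq> {1..}"
    using ab by auto
  have "(LBINT \<sigma>=ereal a..ereal b. (d\<eta> \<sigma> - d\<eta> a) * dW \<sigma>) = (Q b - d\<eta> a * W b) - (Q a - d\<eta> a * W a)"
  proof (rule interval_integral_FTC_finite)
    show "continuous_on {min a b..max a b} (\<lambda>\<sigma>. (d\<eta> \<sigma> - d\<eta> a) * dW \<sigma>)"
      by (intro continuous_intros continuous_on_subset[OF dWc sub] continuous_on_subset[OF d\<eta>c]) auto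
    show "((\<lambda>\<sigma>. Q \<sigma> - d\<eta> a * W \<sigma>) has_vector_derivative (d\<eta> x - d\<eta> a) * dW x) (at x within {min a b..max a b})"
      if "min a b \<le> x" "x \<le> max a b" for x
      unfolding has_real_derivative_iff_has_vector_derivative[symmetric]
      by (rule has_field_derivative_subset[OF entropy_remainder_deriv sub]) (use that ab in auto)
  qed
  then show ?thesis unfolding inner by (simp add: algebra_simps)
qed

text \<open>The factor \<open>d\<eta> x - d\<eta> a\<close> changes sign at \<open>a\<close>
  together with the orientation from \<open>a\<close> to \<open>b\<close>; for \<open>b < a\<close>
  the argument is applied to the negated function on \<open>{b..a}\<close>.\<close>

lemma entropy_remainder_nonneg:
  assumes dW0: "\<And>x. 1 \<le> x \<Longrightarrow> 0 \<le> dW x" and mono: "mono d\<eta>" and ab: "1 \<le> a" "1 \<le> b"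
  shows "0 \<le> (Q b - Q a) - d\<eta> a * (W b - W a)"
proof (cases "a \<le> b")
  case True
  have "Q a - d\<eta> a * W a \<le> Q b - d\<eta> a * W b"
  proof (rule increment_nonneg[OF True, where F = "\<lambda>\<sigma>. Q \<sigma> - d\<eta> a * W \<sigma>" and f = "\<lambda>x. (d\<eta> x - d\<eta> a) * dW x"])
    fix x assume x: "x \<in> {a..b}"
    show "((\<lambda>\<sigma>. Q \<sigma> - d\<eta> a * W \<sigma>) has_real_derivative (d\<eta> x - d\<eta> a) * dW x) (at x within {a..b})"
      by (rule has_field_derivative_subset[OF entropy_remainder_deriv]) (use x ab in auto)
    show "0 \<le> (d\<eta> x - d\<eta> a) * dW x"
      using x ab dW0[of x] monoD[OF mono, of a x] by auto
  qed
  then show ?thesis by (simp add: algebra_simps)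
next
  case False
  have "d\<eta> a * W b - Q b \<le> d\<eta> a * W a - Q a"
  proof (rule increment_nonneg[where F = "\<lambda>\<sigma>. d\<eta> a * W \<sigma> - Q \<sigma>" and f = "\<lambda>x. (d\<eta> a - d\<eta> x) * dW x"])
    fix x assume x: "x \<in> {b..a}"
    have "((\<lambda>\<sigma>. - (Q \<sigma> - d\<eta> a * W \<sigma>)) has_real_derivative - ((d\<eta> x - d\<eta> a) * dW x)) (at x within {b..a})"
      by (rule DERIV_minus[OF has_field_derivative_subset[OF entropy_remainder_deriv]]) (use x ab in auto)
    then show "((\<lambda>\<sigma>. d\<eta> a * W \<sigma> - Q \<sigma>) has_real_derivative (d\<eta> a - d\<eta> x) * dW x) (at x within {b..a})"
      by (simp add: algebra_simps)
    show "0 \<le> (d\<eta> a - d\<eta> x) * dW x"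
      using x ab dW0[of x] monoD[OF mono, of x a] by auto
  qed (use False in simp)
  then show ?thesis by (simp add: algebra_simps)
qed

end

section \<open>From the hypotheses on solution, kernel, flux and entropy to the analytic
  setting\<close>

lemma space_time_lipschitz_compose:
  assumes w: "space_time_lipschitz L w" and range: "\<And>z t. 0 \<le> t \<Longrightarrow> w z t \<in> {1..B}"
    and F: "\<And>x. 1 \<le> x \<Longrightarrow> (F has_real_derivative f x) (at x within {1..})" and f: "continuous_on {1..} f"
  obtains C M where "space_time_lipschitz C (\<lambda>z t. F (w z t))" "\<And>z t. 0 \<le> t \<Longrightarrow> \<bar>F (w z t)\<bar> \<le> M"
proof -
  have L: "0 \<le> L" using w by (simp add: space_time_lipschitz_def)
  have bdd: "\<exists>c. \<forall>x\<in>{1..B}. \<bar>g x\<bar> \<le> c" if "continuous_on {1..} g" for g :: "real \<Rightarrow> real"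
  proof -
    have "compact (g ` {1..B})"
      using that by (intro compact_continuous_image) (auto intro: continuous_on_subset)
    from compact_imp_bounded[OF this] show ?thesis by (auto simp: bounded_iff)
  qed
  \<comment> \<open>The values of \<open>w\<close> stay in the compact interval
    \<open>{1..B}\<close>, where the continuous derivative is bounded; this makes \<open>F\<close>
    Lipschitz there with constant \<open>c\<close>.\<close>
  obtain c where c: "\<And>x. x \<in> {1..B} \<Longrightarrow> \<bar>f x\<bar> \<le> c" using bdd[OF f] by blast
  have c0: "0 \<le> c"
    using order_trans[OF abs_ge_zero c[OF range[of 0 0]]] by simp
  have "continuous_on {1..} F"
    using F by (intro DERIV_continuous_on) auto
  then obtain M where M: "\<And>x. x \<in> {1..B} \<Longrightarrow> \<bar>F x\<bar> \<le> M" using bdd by blast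
  have lip: "\<bar>F x - F y\<bar> \<le> c * \<bar>x - y\<bar>" if "x \<in> {1..B}" "y \<in> {1..B}" for x y
  proof -
    have "norm (F x - F y) \<le> c * norm (x - y)"
    proof (rule field_differentiable_bound[of "{1..B}" F f])
      show "(F has_field_derivative f u) (at u within {1..B})" if "u \<in> {1..B}" for u
        by (rule has_field_derivative_subset[OF F]) (use that in auto)
    qed (use c that in auto)
    then show ?thesis by simp
  qed
  show ?thesis
  proof (rule that)
    show "space_time_lipschitz (c * L) (\<lambda>z t. F (w z t))"
      unfolding space_time_lipschitz_def
    proof (intro conjI allI impI)
      show "0 \<le> c * L" using c0 L by simp
      fix z z' t t' :: real assume t: "0 \<le> t" "0 \<le> t'"
      have "\<bar>F (w z t) - F (w z' t')\<bar> \<le> c * \<bar>w z t - w z' t'\<bar>"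
        using range t by (intro lip)
      also have "\<dots> \<le> c * (L * (\<bar>z - z'\<bar> + \<bar>t - t'\<bar>))"
        by (intro mult_left_mono space_time_lipschitzD[OF w t] c0)
      finally show "\<bar>F (w z t) - F (w z' t')\<bar> \<le> c * L * (\<bar>z - z'\<bar> + \<bar>t - t'\<bar>)"
        by (simp add: mult_ac)
    qed
    show "\<bar>F (w z t)\<bar> \<le> M" if "0 \<le> t" for z t
      using M[OF range[OF that]] .
  qed
qed

text \<open>\<open>dPa\<close> is given only as a derivative of \<open>Phi_alpha\<close>; uniqueness
  identifies it with \<open>d\<Phi> (x / \<alpha>) / \<alpha>\<^sup>2\<close>, which inherits
  continuity from \<open>d\<Phi>\<close>. The scaling by \<alpha> is absorbed here, so the kernel
  estimates can be stated for \<open>k\<close>.\<close>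

lemma decreasing_kernel_Phi_alpha:
  assumes kernel: "kernel \<Phi>"
    and \<Phi>: "\<forall>z\<ge>0. (\<Phi> has_real_derivative d\<Phi> z) (at z within {0..})" "continuous_on {0..} d\<Phi>"
    and dPa: "\<forall>\<zeta>\<ge>0. (Phi_alpha \<Phi> \<alpha> has_real_derivative dPa \<zeta>) (at \<zeta> within {0..})"
    and \<alpha>: "\<alpha> > 0"
  shows "decreasing_kernel (Phi_alpha \<Phi> \<alpha>) dPa"
proof
  show "0 \<le> Phi_alpha \<Phi> \<alpha> x" if "0 \<le> x" for x
    using kernel \<alpha> that by (simp add: kernel_def Phi_alpha_def)
  show "Phi_alpha \<Phi> \<alpha> y \<le> Phi_alpha \<Phi> \<alpha> x" if "0 \<le> x" "x \<le> y" for x y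
  proof -
    have "\<Phi> (y / \<alpha>) \<le> \<Phi> (x / \<alpha>)"
      using kernel \<alpha> that by (simp add: kernel_def divide_right_mono)
    then show ?thesis using \<alpha> by (simp add: Phi_alpha_def divide_right_mono)
  qed
  show "(Phi_alpha \<Phi> \<alpha> has_real_derivative dPa x) (at x within {0..})" if "0 \<le> x" for x
    using dPa that by simp
  have "dPa x = d\<Phi> (x / \<alpha>) / \<alpha>\<^sup>2" if x: "0 \<le> x" for x
  proof (rule deriv_atLeast_unique[OF _ _ x])
    show "(Phi_alpha \<Phi> \<alpha> has_real_derivative dPa x) (at x within {0..})"
      using dPa x by simp
    have "(\<Phi> has_real_derivative d\<Phi> (x / \<alpha>)) (at (x / \<alpha>) within (\<lambda>x. x / \<alpha>) ` {0..})"
      by (rule has_field_derivative_subset[where s = "{0..}"]) (use \<Phi>(1) x \<alpha> in auto)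
    then have "((\<Phi> \<circ> (\<lambda>x. x / \<alpha>)) has_real_derivative d\<Phi> (x / \<alpha>) * (1 / \<alpha>)) (at x within {0..})"
      by (rule DERIV_image_chain) (use \<alpha> in \<open>auto intro!: derivative_eq_intros\<close>)
    from DERIV_cdivide[OF this, of \<alpha>]
    show "(Phi_alpha \<Phi> \<alpha> has_real_derivative d\<Phi> (x / \<alpha>) / \<alpha>\<^sup>2) (at x within {0..})"
      by (simp add: Phi_alpha_def[abs_def] o_def power2_eq_square)
  qed
  moreover have "continuous_on {0..} (\<lambda>x. d\<Phi> (x / \<alpha>) / \<alpha>\<^sup>2)"
    using \<alpha> by (intro continuous_intros continuous_on_compose2[OF \<Phi>(2)]) auto
  ultimately show "continuous_on {0..} dPa"
    by (metis (no_types, lifting) atLeast_iff continuous_on_cong)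
  have "integrable lborel (\<lambda>x. indicator {0..} x *\<^sub>R \<Phi> x)"
    using kernel by (simp add: kernel_def set_integrable_def)
  from lborel_integrable_real_affine[OF this, of "1 / \<alpha>" 0] \<alpha>
  have "integrable lborel (\<lambda>x. indicator {0..} (x / \<alpha>) *\<^sub>R \<Phi> (x / \<alpha>) / \<alpha>)"
    by simp
  moreover have "(\<lambda>x. indicator {0..} (x / \<alpha>) *\<^sub>R \<Phi> (x / \<alpha>) / \<alpha>) = (\<lambda>x. indicator {0..} x *\<^sub>R Phi_alpha \<Phi> \<alpha> x)"
    using \<alpha> by (auto simp: fun_eq_iff Phi_alpha_def indicator_def zero_le_divide_iff)
  ultimately show "set_integrable lborel {0..} (Phi_alpha \<Phi> \<alpha>)"
    by (simp add: set_integrable_def)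
qed

text \<open>By the same uniqueness \<open>dW x = - dV (1 / x) / x\<^sup>2\<close>. The minus sign
  from \<open>1 / x\<close> meets the one from the non-increasing \<open>V\<close>, which makes
  \<open>dW\<close> nonnegative.\<close>

lemma Wflux_deriv_continuous_nonneg:
  assumes V: "\<forall>x\<ge>0. (V has_real_derivative dV x) (at x within {0..})" "continuous_on {0..} dV"
    and mono: "\<forall>x y. 0 \<le> x \<longrightarrow> x \<le> y \<longrightarrow> V y \<le> V x"
    and dW: "\<forall>x\<ge>1. (Wflux V has_real_derivative dW x) (at x within {1..})"
  shows "continuous_on {1..} dW" "\<And>x. 1 \<le> x \<Longrightarrow> 0 \<le> dW x"
proof -
  have eq: "dW x = - dV (1 / x) / x\<^sup>2" if x: "1 \<le> x" for x
  proof (rule deriv_atLeast_unique[OF _ _ x])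
    show "(Wflux V has_real_derivative dW x) (at x within {1..})"
      using dW x by simp
    have "(V has_real_derivative dV (1 / x)) (at (1 / x) within (\<lambda>x. 1 / x) ` {1..})"
      by (rule has_field_derivative_subset[where s = "{0..}"]) (use V(1) x in auto)
    then have "((V \<circ> (\<lambda>x. 1 / x)) has_real_derivative dV (1 / x) * (- 1 / x\<^sup>2)) (at x within {1..})"
      by (rule DERIV_image_chain) (use x in \<open>auto intro!: derivative_eq_intros simp: power2_eq_square\<close>)
    then show "(Wflux V has_real_derivative - dV (1 / x) / x\<^sup>2) (at x within {1..})"
      by (simp add: Wflux_def[abs_def] o_def)
  qed
  have "continuous_on {1..} (\<lambda>x. - dV (1 / x) / x\<^sup>2)"
    by (intro continuous_intros continuous_on_compose2[OF V(2)]) auto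
  then show "continuous_on {1..} dW"
    by (rule continuous_on_eq) (simp add: eq)
  show "0 \<le> dW x" if "1 \<le> x" for x
  proof -
    have "dV (1 / x) \<le> 0"
      by (rule deriv_atLeast_nonpos[of V _ "1 / x" 0]) (use V(1) mono that in auto)
    then show ?thesis using eq[OF that] by (simp add: divide_nonpos_nonneg)
  qed
qed

lemma lipschitz_on_imp_space_time_lipschitz:
  assumes "L-lipschitz_on (UNIV \<times> {0..}) (\<lambda>(z, t). w z t)"
  shows "space_time_lipschitz L w"
  unfolding space_time_lipschitz_def
proof (intro conjI allI impI)
  show L: "0 \<le> L" using assms by (rule lipschitz_on_nonneg)
  fix z z' t t' :: real assume t: "0 \<le> t" "0 \<le> t'"
  have "\<bar>w z t - w z' t'\<bar> \<le> L * dist (z, t) (z', t')"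
    using lipschitz_onD[OF assms, of "(z, t)" "(z', t')"] t by (simp add: dist_real_def)
  also have "\<dots> \<le> L * (\<bar>z - z'\<bar> + \<bar>t - t'\<bar>)"
    using L by (intro mult_left_mono) (auto simp: dist_Pair_Pair dist_real_def sqrt_sum_squares_le_sum_abs[THEN order_trans])
  finally show "\<bar>w z t - w z' t'\<bar> \<le> L * (\<bar>z - z'\<bar> + \<bar>t - t'\<bar>)" .
qed

text \<open>The tangent-line inequalities at \<open>x\<close> and at \<open>y\<close> add up to
  \<open>(d\<eta> y - d\<eta> x) * (y - x) \<ge> 0\<close>.\<close>

lemma convex_imp_mono_deriv:
  fixes \<eta> :: "real \<Rightarrow> real"
  assumes "convex_on UNIV \<eta>" "\<And>x. (\<eta> has_real_derivative d\<eta> x) (at x)"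
  shows "mono d\<eta>"
proof (rule monoI)
  fix x y :: real assume "x \<le> y"
  have "d\<eta> x * (y - x) \<le> \<eta> y - \<eta> x" "d\<eta> y * (x - y) \<le> \<eta> x - \<eta> y"
    by (rule convex_on_imp_above_tangent[OF assms(1)]; use assms(2) in \<open>auto intro: has_field_derivative_at_within\<close>)+
  then have "0 \<le> (d\<eta> y - d\<eta> x) * (y - x)" by (simp add: algebra_simps)
  then show "d\<eta> x \<le> d\<eta> y" using \<open>x \<le> y\<close> by (cases "x = y") (auto simp: zero_le_mult_iff)
qed

theorem theorem5p1:
  fixes \<Phi> d\<Phi> dPa :: "real \<Rightarrow> real" and \<alpha> :: real
    and V dV dW :: "real \<Rightarrow> real"
    and y0 :: "real \<Rightarrow> real" and w :: "real \<Rightarrow> real \<Rightarrow> real"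
    and \<eta> d\<eta> d2\<eta> Q :: "real \<Rightarrow> real"
  assumes kernel: "kernel \<Phi>"
    and \<Phi>_C1: "\<forall>z\<ge>0. (\<Phi> has_real_derivative d\<Phi> z) (at z within {0..})" "continuous_on {0..} d\<Phi>"
    and dPa: "\<forall>\<zeta>\<ge>0. (Phi_alpha \<Phi> \<alpha> has_real_derivative dPa \<zeta>) (at \<zeta> within {0..})"
    and V_C1: "\<forall>x\<ge>0. (V has_real_derivative dV x) (at x within {0..})" "continuous_on {0..} dV"
    and V_mono: "\<forall>x y. 0 \<le> x \<longrightarrow> x \<le> y \<longrightarrow> V y \<le> V x"
    and dW: "\<forall>x\<ge>1. (Wflux V has_real_derivative dW x) (at x within {1..})"
    and \<alpha>: "\<alpha> > 0"
    and y0: "BV y0" "\<forall>x. y0 x \<ge> 1"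
    and w_bounded: "bounded ((\<lambda>(z, t). w z t) ` (UNIV \<times> {0..}))"
    and w_lip: "\<exists>L. L-lipschitz_on (UNIV \<times> {0..}) (\<lambda>(z, t). w z t)"
    and w_ge1: "\<forall>z t. t \<ge> 0 \<longrightarrow> w z t \<ge> 1"
    and w_weak: "weak_solution \<Phi> \<alpha> V w (mollify \<Phi> \<alpha> y0)"
    and \<eta>_C2: "\<forall>x. (\<eta> has_real_derivative d\<eta> x) (at x)"
      "\<forall>x. (d\<eta> has_real_derivative d2\<eta> x) (at x)" "continuous_on UNIV d2\<eta>"
    and \<eta>_convex: "convex_on UNIV \<eta>"
    and Q: "\<forall>x\<ge>1. (Q has_real_derivative d\<eta> x * dW x) (at x within {1..})"
  shows "(\<forall>z t. t \<ge> 0 \<longrightarrow> dissipation dPa d2\<eta> dW w z t \<ge> 0)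
    \<and> (\<forall>\<phi> \<phi>z \<phi>t. test_fun \<phi> \<phi>z \<phi>t \<and> tsupport \<phi> \<subseteq> UNIV \<times> {0<..} \<longrightarrow>
         (LINT t:{0<..}|lborel. LINT z|lborel.
            \<eta> (w z t) * \<phi>t (z, t) - dissipation dPa d2\<eta> dW w z t * \<phi> (z, t)
            - mollify \<Phi> \<alpha> (\<lambda>s. Q (w s t)) z * \<phi>z (z, t)) = 0)
    \<and> (AE p in lborel. snd p > 0 \<longrightarrow>
         (\<exists>a b. ((\<lambda>s. \<eta> (w (fst p) s)) has_real_derivative a) (at (snd p))
             \<and> ((\<lambda>y. mollify \<Phi> \<alpha> (\<lambda>s. Q (w s (snd p))) y) has_real_derivative b) (at (fst p))
             \<and> a + dissipation dPa d2\<eta> dW w (fst p) (snd p) = b))"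
proof -
  interpret decreasing_kernel "Phi_alpha \<Phi> \<alpha>" dPa
    by (rule decreasing_kernel_Phi_alpha[OF kernel \<Phi>_C1 dPa \<alpha>])
  note dWc = Wflux_deriv_continuous_nonneg(1)[OF V_C1 V_mono dW]
  note dW0 = Wflux_deriv_continuous_nonneg(2)[OF V_C1 V_mono dW]
  have W: "(Wflux V has_real_derivative dW x) (at x within {1..})" if "1 \<le> x" for x
    using dW that by simp
  have Q': "(Q has_real_derivative d\<eta> x * dW x) (at x within {1..})" if "1 \<le> x" for x
    using Q that by simp
  have \<eta>: "(\<eta> has_real_derivative d\<eta> x) (at x)" and d\<eta>: "(d\<eta> has_real_derivative d2\<eta> x) (at x)" for x
    using \<eta>_C2 by auto
  have d\<eta>c: "continuous_on S d\<eta>" for S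
    by (rule DERIV_continuous_on[OF has_field_derivative_at_within[OF d\<eta>]])
  have mono: "mono d\<eta>"
    by (rule convex_imp_mono_deriv[OF \<eta>_convex \<eta>])
  obtain L where w: "space_time_lipschitz L w"
    using w_lip lipschitz_on_imp_space_time_lipschitz by blast
  obtain B where B: "\<And>z t. 0 \<le> t \<Longrightarrow> \<bar>w z t\<bar> \<le> B"
    using w_bounded by (force simp: bounded_iff)
  have range: "w z t \<in> {1..B}" if "0 \<le> t" for z t
    using w_ge1 B[OF that, of z] that by auto
  obtain CW MW where hW: "space_time_lipschitz CW (\<lambda>z t. Wflux V (w z t))"
      and MW: "\<And>z t. 0 \<le> t \<Longrightarrow> \<bar>Wflux V (w z t)\<bar> \<le> MW"
    using space_time_lipschitz_compose[OF w range W dWc] by blast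
  have "continuous_on {1..} (\<lambda>x. d\<eta> x * dW x)"
    by (intro continuous_intros d\<eta>c dWc)
  then obtain CQ MQ where hQ: "space_time_lipschitz CQ (\<lambda>z t. Q (w z t))"
      and MQ: "\<And>z t. 0 \<le> t \<Longrightarrow> \<bar>Q (w z t)\<bar> \<le> MQ"
    using space_time_lipschitz_compose[OF w range Q'] by blast
  define J where "J = (\<lambda>z t. jump (\<lambda>s. Wflux V (w s t)) z)"
  define JQ where "JQ = (\<lambda>z t. jump (\<lambda>s. Q (w s t)) z)"
  let ?D = "dissipation dPa d2\<eta> dW w"
  let ?N = "\<lambda>z t. mollify \<Phi> \<alpha> (\<lambda>s. Q (w s t)) z"
  have J: "space_time_lipschitz (2 * CW * Phi_alpha \<Phi> \<alpha> 0) J"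
    unfolding J_def by (rule space_time_lipschitz_jump[OF hW MW])
  have JQ: "space_time_lipschitz (2 * CQ * Phi_alpha \<Phi> \<alpha> 0) JQ"
    unfolding JQ_def by (rule space_time_lipschitz_jump[OF hQ MQ])
  have N: "((\<lambda>y. ?N y t) has_real_derivative JQ z t) (at z)" if "0 \<le> t" for z t
    unfolding mollify_def JQ_def by (rule space_time_lipschitz_kernel_integral_deriv[OF hQ MQ that])
  have wt: "((\<lambda>s. w z s) has_real_derivative J z t) (at t)" if t: "0 < t" for z t
    unfolding J_def
  proof (rule weak_solution_pointwise_deriv[OF w hW MW _ t])
    show "(LINT t:{0..T}|lborel. LINT z|lborel. w z t * \<phi>t (z, t)
          - (LINT \<zeta>:{0..}|lborel. Phi_alpha \<Phi> \<alpha> \<zeta> * Wflux V (w (z + \<zeta>) t)) * \<phi>z (z, t))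
        = (LINT z|lborel. w z T * \<phi> (z, T) - mollify \<Phi> \<alpha> y0 z * \<phi> (z, 0))"
      if "0 < T" "test_fun \<phi> \<phi>z \<phi>t" for T \<phi> \<phi>z \<phi>t
      \<comment> \<open>The initial datum enters as an arbitrary \<open>w0\<close> and stays folded;
        only the flux average is expanded.\<close>
      using w_weak that unfolding weak_solution_def mollify_def[of _ _ "\<lambda>s. Wflux V (w s _)"] by blast
  qed
  have remainder: "(LBINT \<sigma>=ereal (w z t)..ereal (w (z + \<zeta>) t).
        (LBINT \<mu>=ereal (w z t)..ereal \<sigma>. d2\<eta> \<mu> * dW \<sigma>))
      = (Q (w (z + \<zeta>) t) - Q (w z t)) - d\<eta> (w z t) * (Wflux V (w (z + \<zeta>) t) - Wflux V (w z t))"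
    if "0 \<le> t" for z t \<zeta>
    using w_ge1 that by (intro entropy_remainder_eq[OF W Q' dWc d\<eta> \<eta>_C2(3)]) auto
  have D_nonneg: "0 \<le> ?D z t" if t: "0 \<le> t" for z t
  proof -
    have "0 \<le> - dPa \<zeta> * ((Q (w (z + \<zeta>) t) - Q (w z t)) - d\<eta> (w z t) * (Wflux V (w (z + \<zeta>) t) - Wflux V (w z t)))"
      if "0 \<le> \<zeta>" for \<zeta>
      using k'_nonpos[OF that] w_ge1 t
      by (intro mult_nonneg_nonneg entropy_remainder_nonneg[OF W Q' dW0 mono]) auto
    then show ?thesis
      unfolding dissipation_def remainder[OF t] set_lebesgue_integral_def
      by (intro Bochner_Integration.integral_nonneg) (auto simp: indicator_def)
  qed
  \<comment> \<open>The integral may be split because both jump integrals converge separately, and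
    \<open>d\<eta> (w z t)\<close> does not depend on \<zeta>.\<close>
  have D_eq: "?D z t = JQ z t - d\<eta> (w z t) * J z t" if t: "0 \<le> t" for z t
  proof -
    have "?D z t = (LINT \<zeta>:{0..}|lborel. - dPa \<zeta> * (Q (w (z + \<zeta>) t) - Q (w z t))
        - d\<eta> (w z t) * (- dPa \<zeta> * (Wflux V (w (z + \<zeta>) t) - Wflux V (w z t))))"
      unfolding dissipation_def remainder[OF t]
      by (rule set_lebesgue_integral_cong) (auto simp: algebra_simps)
    also have "\<dots> = JQ z t - d\<eta> (w z t) * J z t"
      unfolding JQ_def J_def jump_def set_integral_mult_right[symmetric]
      by (intro set_integral_diff(2) set_integrable_mult_right
          jump_integrable[OF space_time_lipschitz_continuous_space[OF hQ t] MQ[OF t]]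
          jump_integrable[OF space_time_lipschitz_continuous_space[OF hW t] MW[OF t]])
    finally show ?thesis .
  qed
  have Ut: "((\<lambda>s. \<eta> (w z s)) has_real_derivative d\<eta> (w z t) * J z t) (at t)" if "0 < t" for z t
    by (rule DERIV_chain2[OF \<eta> wt[OF that]])
  have comp: "continuous_on (UNIV \<times> {0<..}) (\<lambda>(z, t). f (w z t))" if "continuous_on UNIV f" for f :: "real \<Rightarrow> real"
  proof -
    have "continuous_on (UNIV \<times> {0<..}) (\<lambda>p. f (case p of (z, t) \<Rightarrow> w z t))"
      by (rule continuous_on_compose2[OF that continuous_on_subset[OF space_time_lipschitz_continuous[OF w]]]) auto
    then show ?thesis by (simp add: case_prod_unfold)
  qed
  have "(LINT t:{0<..}|lborel. LINT z|lborel.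
      \<eta> (w z t) * \<phi>t (z, t) - ?D z t * \<phi> (z, t) - ?N z t * \<phi>z (z, t)) = 0"
    if "test_fun \<phi> \<phi>z \<phi>t" "tsupport \<phi> \<subseteq> UNIV \<times> {0<..}" for \<phi> \<phi>z \<phi>t
  proof (rule pointwise_balance_imp_distributional[OF Ut _ _ N _ _ that])
    show "continuous_on (UNIV \<times> {0<..}) (\<lambda>(z, t). \<eta> (w z t))"
      by (rule comp[OF DERIV_continuous_on[OF has_field_derivative_at_within[OF \<eta>]]])
    have "continuous_on (UNIV \<times> {0<..}) (\<lambda>p. (case p of (z, t) \<Rightarrow> d\<eta> (w z t)) * (case p of (z, t) \<Rightarrow> J z t))"
      by (intro continuous_on_mult comp[OF d\<eta>c] continuous_on_subset[OF space_time_lipschitz_continuous[OF J]]) auto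
    then show "continuous_on (UNIV \<times> {0<..}) (\<lambda>(z, t). d\<eta> (w z t) * J z t)"
      by (simp add: case_prod_unfold)
    show "continuous_on UNIV (\<lambda>z. JQ z t)" if "0 < t" for t
      by (rule space_time_lipschitz_continuous_space[OF JQ]) (use that in simp)
  qed (auto simp: D_eq)
  \<comment> \<open>Both derivatives exist at every point with \<open>t > 0\<close>, so the
    almost-everywhere claim has no exceptional set.\<close>
  moreover have "\<exists>a b. ((\<lambda>s. \<eta> (w z s)) has_real_derivative a) (at t)
      \<and> ((\<lambda>y. ?N y t) has_real_derivative b) (at z) \<and> a + ?D z t = b" if "0 < t" for z t
    using Ut[OF that, of z] N[of t z] D_eq[of t z] that
    by (intro exI[of _ "d\<eta> (w z t) * J z t"] exI[of _ "JQ z t"]) auto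
  ultimately show ?thesis
    using D_nonneg by (intro conjI allI impI AE_I2) blast+
qed

end
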